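(* Fix $\alpha>0$ and $0<T<\infty$. Let $y_0\in BV(\mathbb R)$ with $y_0\ge1$, and let the discrete initial data be the cell averages $y_{0,i}=\frac1{\Delta z}\int_{z_{i-1/2}}^{z_{i+1/2}}y_0(z)\,dz$. Let $\Delta t\to0$ and $\Delta z\to0$ in such a way that the CFL condition $0\le\lambda\sup_{w\ge1}W'(w)\le1$ always holds, and assume that $|\partial_z w_{\Delta t,\alpha}(z,0)|\le M$ for a constant $M$ independent of $\Delta t$ (possibly depending on $\alpha$). Then there exists a Lipschitz continuous function $w_\alpha:\mathbb R\times[0,T]\to\mathbb R$ such that $w_{\Delta t,\alpha}\to w_\alpha$ in $C(K\times[0,T])$ for every compact $K\subset\mathbb R$, and $w_\alpha$ is a weak solution of $$\partial_t w_\alpha=\partial_z\overline{W(w_\alpha)},\quad z\in\mathbb R,\ 0<t\le T,\qquad w_\alpha(z,0)=\overline{y_0}(z),$$ i.e. $$\int_0^T\!\!\int_{\mathbb R} w_\alpha\,\partial_t\varphi-\overline{W(w_\alpha)}\,\partial_z\varphi\,dz\,dt=\int_{\mathbb R}w_\alpha(z,T)\varphi(z,T)-w_\alpha(z,0)\varphi(z,0)\,dz$$ for all $\varphi\in C_0^\infty(\mathbb R\times[0,T])$. Moreover, such a Lipschitz continuous weak solution is uniquely determined by its initial data.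
   Context: Kernel: $\Phi:[0,\infty)\to[0,\infty)$ is non-increasing with $\int_0^\infty\Phi(z)\,dz=1$ and $\int_0^\infty z\Phi(z)\,dz<\infty$; for $\alpha>0$, $\Phi_\alpha(z)=\alpha^{-1}\Phi(z/\alpha)$, and for bounded measurable $h:\mathbb R\to\mathbb R$ the averaging operator is $\overline h(z)=\int_0^\infty\Phi_\alpha(\zeta)h(z+\zeta)\,d\zeta$. Flux: $V\in C^1([0,\infty))$ is non-increasing and $W:[1,\infty)\to\mathbb R$, $W(w)=V(1/w)$. Discretization: $\Delta z>0$, $\Delta t>0$, $\lambda=\Delta t/\Delta z$, $z_j=(j-\tfrac12)\Delta z$ for $j\in\tfrac12\mathbb Z$, $t^n=n\Delta t$, and for integers $j\ge i$, $\Phi_{ij\alpha}=\int_{z_{j-1/2}}^{z_{j+1/2}}\Phi_\alpha(\zeta-z_{i-1/2})\,d\zeta$. The scheme: $w^0_i=\sum_{j\ge i}\Phi_{ij\alpha}y_{0,j}$ and $w^{n+1}_i=w^n_i+\lambda(\overline W^{\,n}_{i+1/2}-\overline W^{\,n}_{i-1/2})$ for $n\ge0$, where $\overline W^{\,n}_{i-1/2}=\sum_{j\ge i}\Phi_{ij\alpha}W(w^n_j)$. $w_{\Delta t,\alpha}(z,t)$ denotes the bilinear interpolation of the points $(z_i,t^n,w^n_i)$, $i\in\mathbb Z$, $n\ge0$. *)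

theory Defs
  imports "HOL-Analysis.Analysis"
begin

definition BV_real :: "(real \<Rightarrow> real) \<Rightarrow> bool" where
  "BV_real f \<longleftrightarrow> (\<exists>B. \<forall>xs. sorted xs \<longrightarrow>
      (\<Sum>i<length xs - 1. \<bar>f (xs ! Suc i) - f (xs ! i)\<bar>) \<le> B)"

coinductive Cinf :: "(real \<times> real \<Rightarrow> real) \<Rightarrow> bool" where
  "(\<And>x. (f has_derivative (\<lambda>h. fst h * fz x + snd h * ft x)) (at x))
    \<Longrightarrow> Cinf fz \<Longrightarrow> Cinf ft \<Longrightarrow> Cinf f"

definition Phi_a :: "(real \<Rightarrow> real) \<Rightarrow> real \<Rightarrow> real \<Rightarrow> real" where
  "Phi_a Phi \<alpha> z = Phi (z / \<alpha>) / \<alpha>"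

definition avg :: "(real \<Rightarrow> real) \<Rightarrow> real \<Rightarrow> (real \<Rightarrow> real) \<Rightarrow> real \<Rightarrow> real" where
  "avg Phi \<alpha> h z = (LINT \<zeta>:{0..}|lborel. Phi_a Phi \<alpha> \<zeta> * h (z + \<zeta>))"

definition Wf :: "(real \<Rightarrow> real) \<Rightarrow> real \<Rightarrow> real" where
  "Wf V w = V (1 / w)"

text \<open>Grid points: z_j = (j - 1/2) dz, so z_{j-1/2} = (j-1) dz, z_{j+1/2} = j dz.
  Phi_{ij alpha} = int_{z_{j-1/2}}^{z_{j+1/2}} Phi_alpha(zeta - z_{i-1/2}) dzeta.\<close>
definition Phi_ij :: "(real \<Rightarrow> real) \<Rightarrow> real \<Rightarrow> real \<Rightarrow> int \<Rightarrow> int \<Rightarrow> real" where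
  "Phi_ij Phi \<alpha> dz i j =
     (LINT \<zeta>:{real_of_int (j - 1) * dz .. real_of_int j * dz}|lborel.
        Phi_a Phi \<alpha> (\<zeta> - real_of_int (i - 1) * dz))"

definition cell_avg :: "(real \<Rightarrow> real) \<Rightarrow> real \<Rightarrow> int \<Rightarrow> real" where
  "cell_avg y0 dz i = (1 / dz) *
     (LINT z:{real_of_int (i - 1) * dz .. real_of_int i * dz}|lborel. y0 z)"

text \<open>Averaged flux at the interface i - 1/2:
  sum_{j >= i} Phi_{ij alpha} W(w_j).\<close>
definition Wbar_if :: "(real \<Rightarrow> real) \<Rightarrow> real \<Rightarrow> (real \<Rightarrow> real) \<Rightarrow> real \<Rightarrow> (int \<Rightarrow> real) \<Rightarrow> int \<Rightarrow> real" where
  "Wbar_if Phi \<alpha> V dz w i = (\<Sum>m. Phi_ij Phi \<alpha> dz i (i + int m) * Wf V (w (i + int m)))"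

primrec scheme :: "(real \<Rightarrow> real) \<Rightarrow> real \<Rightarrow> (real \<Rightarrow> real) \<Rightarrow> (real \<Rightarrow> real)
      \<Rightarrow> real \<Rightarrow> real \<Rightarrow> nat \<Rightarrow> int \<Rightarrow> real" where
  "scheme Phi \<alpha> V y0 dz dt 0 i =
     (\<Sum>m. Phi_ij Phi \<alpha> dz i (i + int m) * cell_avg y0 dz (i + int m))"
| "scheme Phi \<alpha> V y0 dz dt (Suc n) i =
     scheme Phi \<alpha> V y0 dz dt n i
     + (dt / dz) * (Wbar_if Phi \<alpha> V dz (scheme Phi \<alpha> V y0 dz dt n) (i + 1)
                    - Wbar_if Phi \<alpha> V dz (scheme Phi \<alpha> V y0 dz dt n) i)"

text \<open>Bilinear interpolation (for t >= 0) of the points (z_i, t^n, g n i),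
  z_i = (i - 1/2) dz, t^n = n dt.\<close>
definition bilin :: "real \<Rightarrow> real \<Rightarrow> (nat \<Rightarrow> int \<Rightarrow> real) \<Rightarrow> real \<Rightarrow> real \<Rightarrow> real" where
  "bilin dz dt g z t =
    (let i = \<lfloor>z / dz + 1 / 2\<rfloor>;
         a = (z - (real_of_int i - 1 / 2) * dz) / dz;
         n = nat \<lfloor>t / dt\<rfloor>;
         b = (t - real n * dt) / dt
     in (1 - a) * (1 - b) * g n i + a * (1 - b) * g n (i + 1)
        + (1 - a) * b * g (Suc n) i + a * b * g (Suc n) (i + 1))"

definition w_approx :: "(real \<Rightarrow> real) \<Rightarrow> real \<Rightarrow> (real \<Rightarrow> real) \<Rightarrow> (real \<Rightarrow> real)
      \<Rightarrow> real \<Rightarrow> real \<Rightarrow> real \<Rightarrow> real \<Rightarrow> real" where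
  "w_approx Phi \<alpha> V y0 dz dt = bilin dz dt (scheme Phi \<alpha> V y0 dz dt)"

definition lipschitz_strip :: "real \<Rightarrow> (real \<Rightarrow> real \<Rightarrow> real) \<Rightarrow> bool" where
  "lipschitz_strip T u \<longleftrightarrow> (\<exists>L. \<forall>z1 z2 t1 t2. t1 \<in> {0..T} \<longrightarrow> t2 \<in> {0..T} \<longrightarrow>
      \<bar>u z1 t1 - u z2 t2\<bar> \<le> L * (\<bar>z1 - z2\<bar> + \<bar>t1 - t2\<bar>))"

definition test_fun :: "real \<Rightarrow> (real \<times> real \<Rightarrow> real) \<Rightarrow> bool" where
  "test_fun T \<phi> \<longleftrightarrow> Cinf \<phi> \<and>
     (\<exists>R. \<forall>z t. t \<in> {0..T} \<longrightarrow> R < \<bar>z\<bar> \<longrightarrow> \<phi> (z, t) = 0)"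

definition weak_sol :: "(real \<Rightarrow> real) \<Rightarrow> real \<Rightarrow> (real \<Rightarrow> real) \<Rightarrow> real
      \<Rightarrow> (real \<Rightarrow> real \<Rightarrow> real) \<Rightarrow> bool" where
  "weak_sol Phi \<alpha> V T u \<longleftrightarrow> (\<forall>\<phi>. test_fun T \<phi> \<longrightarrow>
     (LINT t:{0..T}|lborel. LINT z|lborel.
         u z t * deriv (\<lambda>s. \<phi> (z, s)) t
         - avg Phi \<alpha> (\<lambda>x. Wf V (u x t)) z * deriv (\<lambda>s. \<phi> (s, t)) z)
     = (LINT z|lborel. u z T * \<phi> (z, T) - u z 0 * \<phi> (z, 0)))"

end

theory Submission
  imports Defs
begin

text \<open>
  Since the kernel is non-increasing, its translates satisfy
  \<open>\<integral>\<bar>\<Phi>\<^sub>\<alpha>(x - h) - \<Phi>\<^sub>\<alpha>(x)\<bar> dx \<le> 2 \<Phi>\<^sub>\<alpha>(0) h\<close>, so averaging gains one derivative: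
  \<open>h \<mapsto> \<partial>\<^sub>z (avg h)\<close> is bounded for the supremum norm. The equation is therefore an ordinary
  differential equation with Lipschitz right-hand side in a space of bounded functions. Extending
  \<open>W\<close> below 1 by a constant, Picard iteration yields a global solution that is Lipschitz in both
  variables, and a Gronwall estimate yields uniqueness; testing with products of bump functions shows
  that weak Lipschitz solutions satisfy the integrated equation pointwise. The scheme is an explicit
  Euler method for this equation: the averaged flux at an interface is the average of a step function,
  so the same estimate gives stability, and the errors at the nodes are \<open>O(\<Delta>z + \<Delta>t)\<close>. The CFL
  condition serves to keep the discrete values at least 1.
\<close>

section \<open>Differentiability from second differences\<close>

text \<open>A Lipschitz function such as \<open>av v\<close> is a priori differentiable only almost
  everywhere, while the argument evaluates its derivative pointwise. The translation estimate,
  applied to the difference of \<open>v\<close> and one of its translates, controls second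
  differences too, and this yields a derivative at every point. Lipschitz solutions may grow
  linearly in z, so no norm of the unknown itself is used: the average sees only the bounded
  function W(u), and two solutions with the same data differ by a bounded amount because both are
  Lipschitz in time. The lower bound 1 of the limit is not extracted from the differential equation.
  It is inherited from the discrete values, so the extension of W leaves the equation only after
  convergence to the solution of the extended problem is known.\<close>

lemma continuous_imp_antiderivative:
  fixes f :: "real \<Rightarrow> real"
  assumes "continuous_on UNIV f"
  obtains F where "\<And>x. (F has_real_derivative f x) (at x)"
proof -
  have "\<exists>F. \<forall>x::real. -\<infinity> < ereal x \<longrightarrow> ereal x < \<infinity> \<longrightarrow> (F has_vector_derivative f x) (at x)"
    using assms by (intro einterval_antiderivative) (auto simp: continuous_on_eq_continuous_at)
  then show ?thesis
    using that by (auto simp: has_real_derivative_iff_has_vector_derivative)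
qed

text \<open>The dyadic difference quotients of f converge uniformly, and they are the derivatives of
  the running means of f.\<close>

lemma second_difference_imp_differentiable:
  fixes f :: "real \<Rightarrow> real"
  assumes cont: "continuous_on UNIV f"
    and bd: "\<And>x y h. 0 < h \<Longrightarrow> \<bar>(f (x + h) - f x) - (f (y + h) - f y)\<bar> \<le> K * h * \<bar>x - y\<bar>"
  shows "\<exists>D. (f has_real_derivative D) (at x)"
proof -
  define q where "q n x = 2 ^ n * (f (x + 1 / 2 ^ n) - f x)" for n x
  have step: "norm (q (Suc n) x - q n x) \<le> K / 4 * (1 / 2) ^ n" for n x
  proof -
    define h where "h = (1::real) / 2 ^ Suc n"
    have h: "h > 0" "1 / 2 ^ n = h + h" "(2::real) ^ n * h = 1 / 2" "(1/2) ^ n = 2 * h"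
      by (auto simp: h_def field_simps)
    \<comment> \<open>Halving the increment changes the quotient by a second difference at the
      neighbouring points x and x + h; \<open>bd\<close> bounds it by K h^2, against the factor 2^n
      = 1 / (2 h).\<close>
    have "q (Suc n) x - q n x = 2 ^ n * ((f (x + h) - f x) - (f ((x + h) + h) - f (x + h)))"
      unfolding q_def h(2) h_def[symmetric] by (simp add: algebra_simps)
    also have "norm \<dots> = 2 ^ n * \<bar>(f (x + h) - f x) - (f ((x + h) + h) - f (x + h))\<bar>"
      by (simp add: abs_mult)
    also have "\<dots> \<le> 2 ^ n * (K * h * \<bar>x - (x + h)\<bar>)"
      by (intro mult_left_mono bd h) simp
    also have "\<dots> = (2 ^ n * h) * (K * h)" using h(1) by (simp add: algebra_simps)
    also have "\<dots> = K / 4 * (1 / 2) ^ n" unfolding h(3,4) by simp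
    finally show ?thesis .
  qed
  define G where "G x = (\<Sum>i. q (Suc i) x - q i x) + q 0 x" for x
  have "uniform_limit UNIV (\<lambda>n x. \<Sum>i<n. q (Suc i) x - q i x) (\<lambda>x. \<Sum>i. q (Suc i) x - q i x) sequentially"
    by (intro Weierstrass_m_test[OF step]) (auto intro!: summable_mult summable_geometric)
  then have ul: "uniform_limit UNIV q G sequentially"
    unfolding sum_lessThan_telescope[of "\<lambda>i. q i _"] uniform_limit_iff
    by (simp add: G_def dist_real_def algebra_simps)
  obtain I where I: "\<And>x. (I has_real_derivative f x) (at x)"
    using continuous_imp_antiderivative[OF cont] by blast
  define m where "m n x = 2 ^ n * (I (x + 1 / 2 ^ n) - I x)" for n x
  have m_der: "(m n has_real_derivative q n x) (at x)" for n x
  proof -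
    have "((\<lambda>x. I (x + 1 / 2 ^ n)) has_real_derivative f (x + 1 / 2 ^ n)) (at x)"
      using I[of "x + 1 / 2 ^ n"] by (simp add: DERIV_shift)
    from DERIV_cmult[OF DERIV_diff[OF this I], of "2 ^ n"] show ?thesis
      unfolding q_def by (simp add: m_def[abs_def])
  qed
  have m_lim: "(\<lambda>n. m n x) \<longlonglongrightarrow> f x" for x
  proof -
    have "((\<lambda>h. (I (x + h) - I x) / h) \<longlongrightarrow> f x) (at 0)"
      using I[of x] by (simp add: DERIV_def)
    moreover have "filterlim (\<lambda>n. (1::real) / 2 ^ n) (at 0) sequentially"
      using LIMSEQ_realpow_zero[of "1/2::real"]
      by (auto simp: filterlim_at power_one_over)
    ultimately have "(\<lambda>n. (I (x + 1 / 2 ^ n) - I x) / (1 / 2 ^ n)) \<longlonglongrightarrow> f x"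
      by (rule filterlim_compose)
    then show ?thesis by (simp add: m_def mult.commute)
  qed
  have "\<exists>g. \<forall>x\<in>UNIV. (\<lambda>n. m n x) \<longlonglongrightarrow> g x \<and> (g has_derivative (\<lambda>h. G x * h)) (at x)"
  proof (rule has_derivative_sequence)
    show "(m n has_derivative (\<lambda>h. q n x * h)) (at x)" for n x
      using m_der[of n x] by (simp add: has_field_derivative_def)
    show "\<forall>\<^sub>F n in sequentially. \<forall>x\<in>UNIV. \<forall>h. norm (q n x * h - G x * h) \<le> e * norm h" if "e > 0" for e
      using uniform_limitD[OF ul that]
    proof eventually_elim
      case (elim n)
      show ?case
      proof safe
        fix x h
        have "norm (q n x * h - G x * h) = \<bar>q n x - G x\<bar> * \<bar>h\<bar>"
          by (simp flip: left_diff_distrib add: abs_mult)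
        also have "\<dots> \<le> e * \<bar>h\<bar>"
          using elim by (intro mult_right_mono) (auto simp: dist_real_def less_imp_le)
        finally show "norm (q n x * h - G x * h) \<le> e * norm h" by simp
      qed
    qed
    show "(\<lambda>n. m n 0) \<longlonglongrightarrow> f 0" by (rule m_lim)
  qed auto
  then obtain g where g: "\<And>x. (\<lambda>n. m n x) \<longlonglongrightarrow> g x" "\<And>x. (g has_derivative (\<lambda>h. G x * h)) (at x)"
    by auto
  have "g = f" using LIMSEQ_unique[OF g(1) m_lim] by auto
  with g(2)[of x] show ?thesis by (auto simp: has_field_derivative_def)
qed

section \<open>Smooth bump functions\<close>

text \<open>The powers of 1/x make the family stable under differentiation up to linear
  combinations, so all derivatives of exp(-1/x) are treated at once.\<close>

definition flat :: "nat \<Rightarrow> real \<Rightarrow> real" where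
  "flat k x = (if 0 < x then (1 / x) ^ k * exp (- (1 / x)) else 0)"

lemma flat_has_derivative:
  "(flat k has_real_derivative flat (k + 2) x - real k * flat (k + 1) x) (at x)"
proof -
  consider "x > 0" | "x < 0" | "x = 0" by linarith
  then show ?thesis
  proof cases
    case 1
    have "((\<lambda>x. (1 / x) ^ k * exp (- (1 / x))) has_real_derivative
        flat (k + 2) x - real k * flat (k + 1) x) (at x)"
    proof -
      have inv: "((\<lambda>x. 1 / x) has_real_derivative - (1 / x)\<^sup>2) (at x)"
        using 1 by (auto intro!: derivative_eq_intros simp: field_simps power2_eq_square)
      show ?thesis
        by (rule DERIV_cong[OF DERIV_mult[OF DERIV_power[OF inv] DERIV_fun_exp[OF DERIV_minus[OF inv]]]],
            use 1 in \<open>cases k\<close>) (auto simp: flat_def field_simps power2_eq_square)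
    qed
    then show ?thesis
      by (rule has_field_derivative_transform_within_open[where S="{0<..}"])
        (use 1 in \<open>auto simp: flat_def\<close>)
  next
    case 2
    have "((\<lambda>x. 0) has_real_derivative flat (k + 2) x - real k * flat (k + 1) x) (at x)"
      using 2 by (simp add: flat_def)
    then show ?thesis
      by (rule has_field_derivative_transform_within_open[where S="{..<0}"])
        (use 2 in \<open>auto simp: flat_def\<close>)
  next
    case 3
    \<comment> \<open>With y = 1/h the right difference quotient at 0 is y^(k+1) / exp y, which
      tends to 0 as y grows.\<close>
    have "((\<lambda>h. (1 / h) ^ Suc k / exp (1 / h)) \<longlongrightarrow> (0::real)) (at_right 0)"
      using filterlim_compose[OF tendsto_power_div_exp_0[of "Suc k"] filterlim_inverse_at_top_right]
      by (simp add: inverse_eq_divide)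
    then have "((\<lambda>h. (flat k (0 + h) - flat k 0) / h) \<longlongrightarrow> 0) (at_right 0)"
      by (rule Lim_transform_eventually)
        (auto simp: flat_def eventually_at_right_field exp_minus field_simps intro!: exI[of _ 1])
    moreover have "((\<lambda>h. (flat k (0 + h) - flat k 0) / h) \<longlongrightarrow> 0) (at_left 0)"
      by (rule Lim_transform_eventually[OF tendsto_const])
        (auto simp: flat_def eventually_at_left_field intro!: exI[of _ "-1"])
    ultimately have "((\<lambda>h. (flat k (0 + h) - flat k 0) / h) \<longlongrightarrow> 0) (at 0)"
      by (rule filterlim_split_at_real[rotated])
    then show ?thesis using 3 by (simp add: DERIV_def flat_def)
  qed
qed

text \<open>A class closed under differentiation by construction, hence usable as an invariant for
  the coinductive \<open>Cinf\<close>. The rule \<open>antideriv\<close> admits the time factor of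
  the test functions in \<open>weak_imp_mild\<close>, an antiderivative of a bump.\<close>

inductive smooth1 :: "(real \<Rightarrow> real) \<Rightarrow> bool" where
  flat: "smooth1 (\<lambda>x. flat k (p * x + q))"
| const: "smooth1 (\<lambda>x. c)"
| add: "smooth1 f \<Longrightarrow> smooth1 g \<Longrightarrow> smooth1 (\<lambda>x. f x + g x)"
| mult: "smooth1 f \<Longrightarrow> smooth1 g \<Longrightarrow> smooth1 (\<lambda>x. f x * g x)"
| antideriv: "(\<And>x. (F has_real_derivative f x) (at x)) \<Longrightarrow> smooth1 f \<Longrightarrow> smooth1 F"

lemma smooth1_deriv:
  "smooth1 f \<Longrightarrow> \<exists>f'. smooth1 f' \<and> (\<forall>x. (f has_real_derivative f' x) (at x))"
proof (induction rule: smooth1.induct)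
  case (flat k p q)
  have "smooth1 (\<lambda>x. p * flat (k + 2) (p * x + q) + (- real k * p) * flat (k + 1) (p * x + q))"
    by (intro smooth1.intros)
  moreover have "((\<lambda>x. flat k (p * x + q)) has_real_derivative
      p * flat (k + 2) (p * x + q) + (- real k * p) * flat (k + 1) (p * x + q)) (at x)" for x
    by (rule DERIV_cong[OF DERIV_chain2[OF flat_has_derivative]])
      (auto intro!: derivative_eq_intros simp: algebra_simps)
  ultimately show ?case by blast
next
  case (const c)
  show ?case by (intro exI[of _ "\<lambda>_. 0"]) (auto intro: smooth1.intros)
next
  case (add f g)
  then obtain f' g' where "smooth1 f'" "smooth1 g'" "\<And>x. (f has_real_derivative f' x) (at x)"
    "\<And>x. (g has_real_derivative g' x) (at x)" by blast
  then show ?case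
    by (intro exI[of _ "\<lambda>x. f' x + g' x"]) (auto intro: smooth1.intros DERIV_add)
next
  case (mult f g)
  then obtain f' g' where "smooth1 f'" "smooth1 g'" "\<And>x. (f has_real_derivative f' x) (at x)"
    "\<And>x. (g has_real_derivative g' x) (at x)" by blast
  with mult show ?case
    by (intro exI[of _ "\<lambda>x. f' x * g x + g' x * f x"]) (auto intro: smooth1.intros DERIV_mult)
qed blast

text \<open>Coinduction asks for a set of functions stable under both partial derivatives; the
  products of a \<open>smooth1\<close> function of z with one of t form such a set.\<close>

lemma Cinf_tensor:
  assumes "smooth1 f" "smooth1 g"
  shows "Cinf (\<lambda>x. f (fst x) * g (snd x))"
proof -
  define X where "X h \<longleftrightarrow> (\<exists>f g. smooth1 f \<and> smooth1 g \<and> h = (\<lambda>x. f (fst x) * g (snd x)))" for h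
  have "X (\<lambda>x. f (fst x) * g (snd x))" using assms by (auto simp: X_def)
  then show ?thesis
  proof (rule Cinf.coinduct)
    fix h assume "X h"
    then obtain f g where fg: "smooth1 f" "smooth1 g" and h: "h = (\<lambda>x. f (fst x) * g (snd x))"
      by (auto simp: X_def)
    obtain f' g' where *: "smooth1 f'" "smooth1 g'" "\<And>x. (f has_real_derivative f' x) (at x)"
      "\<And>x. (g has_real_derivative g' x) (at x)"
      using smooth1_deriv fg by metis
    have "(h has_derivative (\<lambda>k. fst k * (f' (fst x) * g (snd x)) + snd k * (f (fst x) * g' (snd x)))) (at x)" for x
    proof -
      have "((\<lambda>x. f (fst x)) has_derivative (\<lambda>k. f' (fst x) * fst k)) (at x)"
        by (rule has_derivative_compose[OF has_derivative_fst[OF has_derivative_ident] *(3)[unfolded has_field_derivative_def]])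
      moreover have "((\<lambda>x. g (snd x)) has_derivative (\<lambda>k. g' (snd x) * snd k)) (at x)"
        by (rule has_derivative_compose[OF has_derivative_snd[OF has_derivative_ident] *(4)[unfolded has_field_derivative_def]])
      ultimately show ?thesis unfolding h
        by (rule has_derivative_eq_rhs[OF has_derivative_mult]) (auto simp: algebra_simps)
    qed
    moreover have "X (\<lambda>x. f' (fst x) * g (snd x))" "X (\<lambda>x. f (fst x) * g' (snd x))"
      using * fg by (auto simp: X_def)
    ultimately show "\<exists>k fz ft. h = k \<and>
        (\<forall>x. (k has_derivative (\<lambda>h. fst h * fz x + snd h * ft x)) (at x)) \<and>
        (X fz \<or> Cinf fz) \<and> (X ft \<or> Cinf ft)"
      by (intro exI[of _ h] exI[of _ "\<lambda>x. f' (fst x) * g (snd x)"]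
          exI[of _ "\<lambda>x. f (fst x) * g' (snd x)"]) simp
  qed
qed

definition bump :: "real \<Rightarrow> real \<Rightarrow> real \<Rightarrow> real" where
  "bump a b x = flat 0 (x - a) * flat 0 (b - x)"

lemma smooth1_bump: "smooth1 (bump a b)"
  using smooth1.mult[OF smooth1.flat[of 0 1 "-a"] smooth1.flat[of 0 "-1" b]]
  by (simp add: bump_def[abs_def])

lemma bump_nonneg: "bump a b x \<ge> 0"
  by (simp add: bump_def flat_def)

lemma bump_pos_iff: "bump a b x > 0 \<longleftrightarrow> a < x \<and> x < b"
  by (auto simp: bump_def flat_def)

lemma bump_outside: "x \<le> a \<or> b \<le> x \<Longrightarrow> bump a b x = 0"
  by (auto simp: bump_def flat_def)

lemma smooth1_continuous: "smooth1 f \<Longrightarrow> continuous_on A f"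
  using smooth1_deriv by (meson DERIV_isCont continuous_at_imp_continuous_on)

lemma continuous_on_bump [continuous_intros]: "continuous_on A (bump a b)"
  by (intro smooth1_continuous smooth1_bump)

text \<open>One-sided fundamental lemma of the calculus of variations: near a point where f is
  positive, a bump makes the integrand nonnegative and continuous with integral zero, hence
  identically zero. Applied to f and to -f it gives the two-sided version.\<close>

lemma integral_bump_zero_imp_nonpos:
  fixes f :: "real \<Rightarrow> real"
  assumes f: "continuous_on {a..b} f"
    and z: "\<And>c d. a < c \<Longrightarrow> c < d \<Longrightarrow> d < b \<Longrightarrow> integral {a..b} (\<lambda>x. f x * bump c d x) = 0"
    and x: "x \<in> {a<..<b}"
  shows "f x \<le> 0"
proof (rule ccontr)
  assume "\<not> f x \<le> 0"
  then have pos: "f x > 0" by simp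
  have "isCont f x"
    using f x continuous_on_interior[of "{a..b}" f x] by simp
  then have "eventually (\<lambda>y. f y > 0) (at x)"
    using pos by (auto simp: isCont_def dest: order_tendstoD)
  then obtain e where e: "e > 0" "\<And>y. dist y x < e \<Longrightarrow> f y > 0"
    using pos unfolding eventually_at by (metis dist_self UNIV_I)
  define r where "r = min (e / 2) (min ((x - a) / 2) ((b - x) / 2))"
  have r: "r > 0" "r < e" "a < x - r" "x + r < b"
    using e x by (auto simp: r_def min_def field_simps)
  have nn: "0 \<le> f y * bump (x - r) (x + r) y" for y
  proof (cases "x - r < y \<and> y < x + r")
    case True
    then have "dist y x < e" using r by (auto simp: dist_real_def)
    then show ?thesis using e(2)[of y] bump_nonneg[of "x - r" "x + r" y] by simp
  qed (auto simp: bump_outside not_less)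
  have "integral {a..b} (\<lambda>y. f y * bump (x - r) (x + r) y) = 0"
    using r by (intro z) auto
  then have "\<forall>y\<in>{a..b}. f y * bump (x - r) (x + r) y = 0"
    using integral_eq_0_iff[of a b "\<lambda>y. f y * bump (x - r) (x + r) y"] nn x
    by (auto intro!: continuous_intros f)
  then have "f x * bump (x - r) (x + r) x = 0" using x by auto
  moreover have "bump (x - r) (x + r) x > 0" using r by (simp add: bump_pos_iff)
  ultimately show False using pos by simp
qed

lemma integral_bump_zero_imp_zero:
  fixes f :: "real \<Rightarrow> real"
  assumes f: "continuous_on {a..b} f"
    and z: "\<And>c d. a < c \<Longrightarrow> c < d \<Longrightarrow> d < b \<Longrightarrow> integral {a..b} (\<lambda>x. f x * bump c d x) = 0"
    and x: "x \<in> {a..b}" and ab: "a < b"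
  shows "f x = 0"
proof -
  have "f y = 0" if "y \<in> {a<..<b}" for y
  proof -
    have "integral {a..b} (\<lambda>x. - f x * bump c d x) = 0" if "a < c" "c < d" "d < b" for c d
      using z[OF that] by simp
    then have "- f y \<le> 0"
      using that f by (intro integral_bump_zero_imp_nonpos[of a b "\<lambda>x. - f x"]) (auto intro!: continuous_intros)
    moreover have "f y \<le> 0" by (rule integral_bump_zero_imp_nonpos[OF f z that])
    ultimately show ?thesis by simp
  qed
  \<comment> \<open>The bumps probe only the open interval; continuity carries the conclusion to the
    end points.\<close>
  then show ?thesis
    using continuous_constant_on_closure[of "{a<..<b}" f 0 x] f x ab by simp
qed

section \<open>Averaging against a non-increasing kernel\<close>

lemma lipschitz_imp_continuous:
  assumes "\<And>x y. \<bar>v x - v y\<bar> \<le> L * \<bar>x - y :: real\<bar>"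
  shows "continuous_on UNIV (v :: real \<Rightarrow> real)"
proof -
  have "0 \<le> L" using assms[of 1 0] by simp
  then have "L-lipschitz_on UNIV v" using assms by (auto simp: lipschitz_on_def dist_real_def)
  then show ?thesis by (rule lipschitz_on_continuous_on)
qed

lemma derivative_bound:
  fixes f :: "real \<Rightarrow> real"
  assumes D: "(f has_real_derivative D) (at z)" and K: "\<And>x y. \<bar>f x - f y\<bar> \<le> K * \<bar>x - y\<bar>"
  shows "\<bar>D\<bar> \<le> K"
proof (rule tendsto_upperbound)
  show "((\<lambda>h. \<bar>(f (z + h) - f z) / h\<bar>) \<longlongrightarrow> \<bar>D\<bar>) (at 0)"
    using D by (intro tendsto_rabs) (simp add: DERIV_def)
  have "\<bar>(f (z + h) - f z) / h\<bar> \<le> K" if "h \<noteq> 0" for h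
    using K[of "z + h" z] that by (simp add: abs_divide divide_le_eq)
  then show "\<forall>\<^sub>F h in at 0. \<bar>(f (z + h) - f z) / h\<bar> \<le> K"
    by (auto simp: eventually_at_filter)
qed simp

text \<open>The kernel is extended by zero to the negative half-line, so that averages are integrals
  over the whole line and a shift of the argument becomes a translation of Lebesgue measure.\<close>

locale kernel =
  fixes F :: "real \<Rightarrow> real"
  assumes F_nonneg: "F x \<ge> 0"
    and F_neg: "x < 0 \<Longrightarrow> F x = 0"
    and F_noninc: "0 \<le> x \<Longrightarrow> x \<le> y \<Longrightarrow> F y \<le> F x"
    and F_integrable: "integrable lborel F"
    and F_integral: "integral\<^sup>L lborel F = 1"
begin

definition av :: "(real \<Rightarrow> real) \<Rightarrow> real \<Rightarrow> real" where
  "av v z = (LINT x|lborel. F x * v (z + x))"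

lemma F_le: "F x \<le> F 0"
  using F_noninc[of 0 x] F_neg[of x] F_nonneg[of 0] by (cases "x < 0") auto

lemma F_measurable [measurable]: "F \<in> borel_measurable borel"
  using borel_measurable_integrable[OF F_integrable] by simp

lemma av_integrable:
  assumes [measurable]: "v \<in> borel_measurable borel" and B: "\<And>x. \<bar>v x\<bar> \<le> B"
  shows "integrable lborel (\<lambda>x. F x * v (z + x))"
proof (rule Bochner_Integration.integrable_bound)
  show "integrable lborel (\<lambda>x. B * F x)" using F_integrable by simp
  have "0 \<le> B" using B[of 0] by linarith
  then show "AE x in lborel. norm (F x * v (z + x)) \<le> norm (B * F x)"
    using mult_left_mono[OF B F_nonneg] F_nonneg by (auto simp: abs_mult mult.commute[of B])
qed measurable

lemma av_bound:
  assumes "v \<in> borel_measurable borel" and B: "\<And>x. \<bar>v x\<bar> \<le> B"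
  shows "\<bar>av v z\<bar> \<le> B"
proof -
  have "\<bar>av v z\<bar> \<le> (LINT x|lborel. \<bar>F x * v (z + x)\<bar>)"
    unfolding av_def by (rule integral_abs_bound)
  also have "\<dots> \<le> (LINT x|lborel. B * F x)"
    using integrable_abs[OF av_integrable[OF assms]] F_integrable mult_left_mono[OF B F_nonneg] F_nonneg
    by (intro integral_mono) (auto simp: abs_mult mult.commute[of B])
  also have "\<dots> = B" by (simp add: F_integral)
  finally show ?thesis .
qed

lemma av_diff:
  assumes "v \<in> borel_measurable borel" "\<And>x. \<bar>v x\<bar> \<le> B"
    and "w \<in> borel_measurable borel" "\<And>x. \<bar>w x\<bar> \<le> C"
  shows "av (\<lambda>x. v x - w x) z = av v z - av w z"
  using av_integrable[OF assms(1,2)] av_integrable[OF assms(3,4)]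
  by (simp add: av_def right_diff_distrib)

lemma av_shift: "av (\<lambda>x. v (x + h)) z = av v (z + h)"
  by (simp add: av_def add_ac)

text \<open>Monotonicity of the kernel makes its translation difference have total mass
  at most twice the mass of \<open>F\<close> on \<open>[0, h]\<close>, hence the operator gains one derivative.\<close>

lemma av_lipschitz_pos:
  assumes [measurable]: "v \<in> borel_measurable borel" and B: "\<And>x. \<bar>v x\<bar> \<le> B" and h: "0 \<le> h"
  shows "\<bar>av v (z + h) - av v z\<bar> \<le> 2 * F 0 * B * h"
proof -
  have B0: "0 \<le> B" using B[of 0] by linarith
  have Fh: "integrable lborel (\<lambda>x. F (x - h))"
    using lborel_integrable_real_affine[OF F_integrable, of 1 "-h"] by simp
  have ind: "integrable lborel (indicator {0..h} :: real \<Rightarrow> real)"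
    by (intro integrable_real_indicator) (use h in auto)
  have Fh1: "(LINT x|lborel. F (x - h)) = 1"
    using lborel_integral_real_affine[of 1 F "-h"] by (simp add: F_integral)
  have vh: "integrable lborel (\<lambda>x. F (x - h) * v (z + x))"
    using lborel_integrable_real_affine[OF av_integrable[OF assms(1,2), of "z + h"], of 1 "-h"]
    by (simp add: algebra_simps)
  have "av v (z + h) = (LINT x|lborel. F (x - h) * v (z + x))"
    unfolding av_def using lborel_integral_real_affine[of 1 "\<lambda>x. F x * v (z + h + x)" "-h"]
    by (simp add: algebra_simps)
  then have "av v (z + h) - av v z = (LINT x|lborel. F (x - h) * v (z + x) - F x * v (z + x))"
    unfolding av_def using vh av_integrable[OF assms(1,2), of z] by simp
  also have "\<bar>\<dots>\<bar> \<le> (LINT x|lborel. \<bar>F (x - h) * v (z + x) - F x * v (z + x)\<bar>)"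
    by (rule integral_abs_bound)
  also have "\<dots> \<le> (LINT x|lborel. B * ((F (x - h) - F x) + 2 * F 0 * indicator {0..h} x))"
  proof (rule integral_mono)
    fix x
    \<comment> \<open>Outside [0, h] the difference F(x - h) - F x is nonnegative; on [0, h] a wrong
      sign costs at most 2 F 0. The difference integrates to zero, so only the indicator term
      survives.\<close>
    have "\<bar>F (x - h) - F x\<bar> \<le> (F (x - h) - F x) + 2 * F 0 * indicator {0..h} x"
    proof -
      consider "x < 0" | "0 \<le> x" "x \<le> h" | "h < x" by linarith
      then show ?thesis
      proof cases
        case 1
        then show ?thesis using F_neg[of x] F_neg[of "x - h"] h by simp
      next
        case 2
        then show ?thesis using F_le[of x] F_nonneg[of "x - h"] F_nonneg[of x] by auto
      next
        case 3
        then show ?thesis using F_noninc[of "x - h" x] h by simp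
      qed
    qed
    then have "\<bar>v (z + x)\<bar> * \<bar>F (x - h) - F x\<bar> \<le> B * ((F (x - h) - F x) + 2 * F 0 * indicator {0..h} x)"
      using B B0 by (intro mult_mono) auto
    then show "\<bar>F (x - h) * v (z + x) - F x * v (z + x)\<bar>
        \<le> B * ((F (x - h) - F x) + 2 * F 0 * indicator {0..h} x)"
      by (simp flip: left_diff_distrib add: abs_mult mult.commute)
  qed (use vh av_integrable[OF assms(1,2), of z] Fh F_integrable ind in auto)
  also have "\<dots> = 2 * F 0 * B * h"
    using Fh F_integrable Fh1 F_integral h ind by simp
  finally show ?thesis .
qed

lemma av_lipschitz:
  assumes "v \<in> borel_measurable borel" "\<And>x. \<bar>v x\<bar> \<le> B"
  shows "\<bar>av v x - av v y\<bar> \<le> 2 * F 0 * B * \<bar>x - y\<bar>"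
  using av_lipschitz_pos[OF assms, of "x - y" y] av_lipschitz_pos[OF assms, of "y - x" x]
  by (cases "y \<le> x") (auto simp: abs_minus_commute)

section \<open>The derivative of the average and its bounds in the supremum norm\<close>

definition dav :: "(real \<Rightarrow> real) \<Rightarrow> real \<Rightarrow> real" where
  "dav v z = deriv (av v) z"

text \<open>The two constants have separate tasks: L secures that \<open>dav\<close> is a true
  derivative, B alone controls its size.\<close>

definition blip :: "real \<Rightarrow> real \<Rightarrow> (real \<Rightarrow> real) \<Rightarrow> bool" where
  "blip B L v \<longleftrightarrow> (\<forall>x. \<bar>v x\<bar> \<le> B) \<and> (\<forall>x y. \<bar>v x - v y\<bar> \<le> L * \<bar>x - y\<bar>)"

lemma blip_measurable: "blip B L v \<Longrightarrow> v \<in> borel_measurable borel"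
  by (intro borel_measurable_continuous_onI lipschitz_imp_continuous[where L=L]) (simp add: blip_def)

text \<open>The translate of v by x - y differs from v by at most L |x - y|. Feeding this difference
  into \<open>av_lipschitz_pos\<close> bounds the second differences of \<open>av v\<close>.\<close>

lemma av_has_derivative:
  assumes v: "blip B L v"
  shows "(av v has_real_derivative dav v z) (at z)"
proof -
  note [measurable] = blip_measurable[OF v]
  have B: "\<And>x. \<bar>v x\<bar> \<le> B" and L: "\<And>x y. \<bar>v x - v y\<bar> \<le> L * \<bar>x - y\<bar>"
    using v by (auto simp: blip_def)
  have "\<exists>D. (av v has_real_derivative D) (at z)"
  proof (rule second_difference_imp_differentiable)
    show "continuous_on UNIV (av v)"
      by (rule lipschitz_imp_continuous, rule av_lipschitz) (use B in auto)
    fix x y h :: real assume "0 < h"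
    let ?w = "\<lambda>s. v (s + (x - y)) - v s"
    have eq: "av ?w s = av v (s + (x - y)) - av v s" for s
      by (subst av_diff[where B=B and C=B]) (use B in \<open>auto simp: av_shift\<close>)
    have "\<bar>av ?w (y + h) - av ?w y\<bar> \<le> 2 * F 0 * (L * \<bar>x - y\<bar>) * h"
    proof (rule av_lipschitz_pos)
      show "\<bar>?w s\<bar> \<le> L * \<bar>x - y\<bar>" for s using L[of "s + (x - y)" s] by simp
    qed (use \<open>0 < h\<close> in auto)
    then show "\<bar>av v (x + h) - av v x - (av v (y + h) - av v y)\<bar> \<le> (2 * F 0 * L) * h * \<bar>x - y\<bar>"
      unfolding eq by (simp add: algebra_simps)
  qed
  then show ?thesis unfolding dav_def by (auto simp: DERIV_imp_deriv)
qed

lemma dav_bound: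
  assumes "blip B L v"
  shows "\<bar>dav v z\<bar> \<le> 2 * F 0 * B"
  using assms
  by (intro derivative_bound[OF av_has_derivative[OF assms]] av_lipschitz blip_measurable)
    (auto simp: blip_def)

text \<open>Neither Lipschitz constant enters the estimate; they only guarantee that the derivatives
  exist. This makes the right-hand side of the evolution equation Lipschitz for the supremum
  norm.\<close>

lemma dav_diff_bound:
  assumes v: "blip B L v" and w: "blip B' L' w" and e: "\<And>x. \<bar>v x - w x\<bar> \<le> e"
  shows "\<bar>dav v z - dav w z\<bar> \<le> 2 * F 0 * e"
proof (rule derivative_bound)
  note [measurable] = blip_measurable[OF v] blip_measurable[OF w]
  show "((\<lambda>x. av v x - av w x) has_real_derivative dav v z - dav w z) (at z)"
    by (intro DERIV_diff av_has_derivative[OF v] av_has_derivative[OF w])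
  have eq: "av v x - av w x = av (\<lambda>x. v x - w x) x" for x
    using v w by (subst av_diff[where B=B and C=B']) (auto simp: blip_def)
  show "\<bar>av v x - av w x - (av v y - av w y)\<bar> \<le> 2 * F 0 * e * \<bar>x - y\<bar>" for x y
    unfolding eq by (rule av_lipschitz) (use e in auto)
qed

lemma dav_shift:
  assumes "blip B L v"
  shows "dav (\<lambda>x. v (x + h)) z = dav v (z + h)"
proof -
  have "(av v has_real_derivative dav v (z + h)) (at (z + h))"
    by (rule av_has_derivative[OF assms])
  then have "((\<lambda>x. av v (x + h)) has_real_derivative dav v (z + h)) (at z)"
    by (simp add: DERIV_shift)
  then show ?thesis unfolding dav_def av_shift[symmetric, abs_def]
    by (simp add: DERIV_imp_deriv flip: av_shift)
qed

text \<open>Differentiated averages commute with translations, so two values of \<open>dav v\<close>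
  are values at one point for v and its translate, which are L |x - y| apart.\<close>

lemma dav_lipschitz:
  assumes v: "blip B L v"
  shows "\<bar>dav v x - dav v y\<bar> \<le> 2 * F 0 * L * \<bar>x - y\<bar>"
proof -
  have s: "blip B L (\<lambda>s. v (s + (x - y)))"
    using v unfolding blip_def by (metis add_diff_cancel_right)
  have "\<bar>dav (\<lambda>s. v (s + (x - y))) y - dav v y\<bar> \<le> 2 * F 0 * (L * \<bar>x - y\<bar>)"
  proof (rule dav_diff_bound[OF s v])
    have "\<bar>v (r + (x - y)) - v r\<bar> \<le> L * \<bar>r + (x - y) - r\<bar>" for r
      using v unfolding blip_def by blast
    then show "\<bar>v (r + (x - y)) - v r\<bar> \<le> L * \<bar>x - y\<bar>" for r by simp
  qed
  then show ?thesis by (simp add: dav_shift[OF v] mult_ac)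
qed

end

section \<open>Mild solutions\<close>

definition lip_on :: "real \<Rightarrow> real \<Rightarrow> (real \<Rightarrow> real \<Rightarrow> real) \<Rightarrow> bool" where
  "lip_on L T u \<longleftrightarrow> (\<forall>z1 z2 t1 t2. t1 \<in> {0..T} \<longrightarrow> t2 \<in> {0..T} \<longrightarrow>
      \<bar>u z1 t1 - u z2 t2\<bar> \<le> L * (\<bar>z1 - z2\<bar> + \<bar>t1 - t2\<bar>))"

lemma lipschitz_strip_iff: "lipschitz_strip T u \<longleftrightarrow> (\<exists>L. lip_on L T u)"
  by (simp add: lipschitz_strip_def lip_on_def)

lemma lip_onD:
  "lip_on L T u \<Longrightarrow> t1 \<in> {0..T} \<Longrightarrow> t2 \<in> {0..T} \<Longrightarrow>
    \<bar>u z1 t1 - u z2 t2\<bar> \<le> L * (\<bar>z1 - z2\<bar> + \<bar>t1 - t2\<bar>)"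
  by (simp add: lip_on_def)

lemma lip_on_space: "lip_on L T u \<Longrightarrow> t \<in> {0..T} \<Longrightarrow> \<bar>u x t - u y t\<bar> \<le> L * \<bar>x - y\<bar>"
  using lip_onD[of L T u t t x y] by simp

lemma lip_on_time: "lip_on L T u \<Longrightarrow> s \<in> {0..T} \<Longrightarrow> t \<in> {0..T} \<Longrightarrow> \<bar>u x s - u x t\<bar> \<le> L * \<bar>s - t\<bar>"
  using lip_onD[of L T u s t x x] by simp

lemma lip_onI:
  assumes z: "\<And>x y t. t \<in> {0..T} \<Longrightarrow> \<bar>u x t - u y t\<bar> \<le> L * \<bar>x - y\<bar>"
    and t: "\<And>x s t. s \<in> {0..T} \<Longrightarrow> t \<in> {0..T} \<Longrightarrow> \<bar>u x s - u x t\<bar> \<le> K * \<bar>s - t\<bar>"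
    and "0 \<le> L" "0 \<le> K"
  shows "lip_on (L + K) T u"
  unfolding lip_on_def
proof (intro allI impI)
  fix z1 z2 t1 t2 assume t12: "t1 \<in> {0..T}" "t2 \<in> {0..T}"
  have "0 \<le> L * \<bar>t1 - t2\<bar>" "0 \<le> K * \<bar>z1 - z2\<bar>" using assms by auto
  then show "\<bar>u z1 t1 - u z2 t2\<bar> \<le> (L + K) * (\<bar>z1 - z2\<bar> + \<bar>t1 - t2\<bar>)"
    using z[OF t12(1), of z1 z2] t[OF t12, of z2] by (simp only: distrib_left distrib_right) linarith
qed

lemma lip_on_nonneg: "lip_on L T u \<Longrightarrow> 0 \<le> T \<Longrightarrow> 0 \<le> L"
  using lip_onD[of L T u 0 0 1 0] by simp

lemma lip_on_continuous:
  assumes "lip_on L T u"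
  shows "continuous_on (UNIV \<times> {0..T}) (\<lambda>x. u (fst x) (snd x))"
proof (cases "0 \<le> T")
  case True
  have "(2 * L)-lipschitz_on (UNIV \<times> {0..T}) (\<lambda>x. u (fst x) (snd x))"
  proof (rule lipschitz_onI)
    fix x y :: "real \<times> real" assume xy: "x \<in> UNIV \<times> {0..T}" "y \<in> UNIV \<times> {0..T}"
    have "\<bar>u (fst x) (snd x) - u (fst y) (snd y)\<bar> \<le> L * (\<bar>fst x - fst y\<bar> + \<bar>snd x - snd y\<bar>)"
      using xy by (intro lip_onD[OF assms]) auto
    also have "\<dots> \<le> L * (dist x y + dist x y)"
      using dist_fst_le[of x y] dist_snd_le[of x y] lip_on_nonneg[OF assms True]
      by (intro mult_left_mono add_mono) (auto simp: dist_real_def)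
    finally show "dist (u (fst x) (snd x)) (u (fst y) (snd y)) \<le> 2 * L * dist x y"
      by (simp add: dist_real_def)
  qed (use lip_on_nonneg[OF assms True] in simp)
  then show ?thesis by (rule lipschitz_on_continuous_on)
qed auto

text \<open>Exponentially weighted norm: the antiderivative of a exp(2 a s) is exp(2 a s) / 2, so
  integrating a right-hand side with Lipschitz constant a halves the weighted distance, however long
  the time interval.\<close>

lemma integral_diff_exp_bound:
  fixes f g :: "real \<Rightarrow> real"
  assumes f: "continuous_on {0..t} f" and g: "continuous_on {0..t} g" and t: "0 \<le> t"
    and le: "\<And>s. s \<in> {0..t} \<Longrightarrow> \<bar>f s - g s\<bar> \<le> a * (K * exp (2 * a * s))" and K: "0 \<le> K"
  shows "\<bar>integral {0..t} f - integral {0..t} g\<bar> \<le> K / 2 * exp (2 * a * t)"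
proof -
  have "((\<lambda>s. a * (K * exp (2 * a * s))) has_integral K / 2 * exp (2 * a * t) - K / 2 * exp (2 * a * 0)) {0..t}"
    using t by (intro fundamental_theorem_of_calculus)
      (auto simp flip: has_real_derivative_iff_has_vector_derivative intro!: derivative_eq_intros)
  note e = this
  have "norm (integral {0..t} (\<lambda>s. f s - g s)) \<le> integral {0..t} (\<lambda>s. a * (K * exp (2 * a * s)))"
    by (rule integral_norm_bound_integral)
      (use le in \<open>auto intro!: integrable_continuous_real continuous_intros f g\<close>)
  also have "\<dots> \<le> K / 2 * exp (2 * a * t)"
    using integral_unique[OF e] K by simp
  finally show ?thesis
    using f g by (simp add: integral_diff integrable_continuous_real)
qed

text \<open>Boundedness is demanded of W and not of the unknown, so averages of W(u) make sense for
  Lipschitz functions u of linear growth.\<close>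

locale nonlocal_flux = kernel F for F :: "real \<Rightarrow> real" +
  fixes W :: "real \<Rightarrow> real" and Bw Lw :: real
  assumes W_bound: "\<bar>W x\<bar> \<le> Bw" and W_lip: "\<bar>W x - W y\<bar> \<le> Lw * \<bar>x - y\<bar>"
begin

definition N :: "(real \<Rightarrow> real \<Rightarrow> real) \<Rightarrow> real \<Rightarrow> real \<Rightarrow> real" where
  "N u t z = dav (\<lambda>x. W (u x t)) z"

text \<open>Lipschitz constant of the right-hand side for the supremum norm: 2 F 0 from
  differentiating the average, \<open>Lw\<close> from the flux.\<close>

definition C :: real where "C = 2 * F 0 * Lw"

lemma Bw_nonneg: "0 \<le> Bw" using W_bound[of 0] by linarith
lemma Lw_nonneg: "0 \<le> Lw" using W_lip[of 1 0] by simp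
lemma C_nonneg: "0 \<le> C" using Lw_nonneg F_nonneg[of 0] by (simp add: C_def)

lemma blip_W:
  assumes "\<And>x y. \<bar>v x - v y\<bar> \<le> L * \<bar>x - y\<bar>"
  shows "blip Bw (Lw * L) (\<lambda>x. W (v x))"
  unfolding blip_def
proof safe
  fix x y
  have "\<bar>W (v x) - W (v y)\<bar> \<le> Lw * \<bar>v x - v y\<bar>" by (rule W_lip)
  also have "\<dots> \<le> Lw * (L * \<bar>x - y\<bar>)" by (intro mult_left_mono assms Lw_nonneg)
  finally show "\<bar>W (v x) - W (v y)\<bar> \<le> Lw * L * \<bar>x - y\<bar>" by simp
qed (rule W_bound)

lemma N_bound:
  assumes "\<And>x y. \<bar>u x t - u y t\<bar> \<le> L * \<bar>x - y\<bar>"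
  shows "\<bar>N u t z\<bar> \<le> 2 * F 0 * Bw"
  unfolding N_def by (rule dav_bound[OF blip_W[OF assms]])

lemma N_lip:
  assumes "\<And>x y. \<bar>u x t - u y t\<bar> \<le> L * \<bar>x - y\<bar>"
  shows "\<bar>N u t x - N u t y\<bar> \<le> C * L * \<bar>x - y\<bar>"
  using dav_lipschitz[OF blip_W[of "\<lambda>x. u x t", OF assms]] by (simp add: N_def C_def mult_ac)

lemma N_diff:
  assumes u: "\<And>x y. \<bar>u x t - u y t\<bar> \<le> L * \<bar>x - y\<bar>" and v: "\<And>x y. \<bar>v x s - v y s\<bar> \<le> L' * \<bar>x - y\<bar>"
    and e: "\<And>x. \<bar>u x t - v x s\<bar> \<le> e"
  shows "\<bar>N u t z - N v s z\<bar> \<le> C * e"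
proof -
  have "\<bar>W (u x t) - W (v x s)\<bar> \<le> Lw * e" for x
    using W_lip[of "u x t" "v x s"] mult_left_mono[OF e[of x] Lw_nonneg] by linarith
  then have "\<bar>dav (\<lambda>x. W (u x t)) z - dav (\<lambda>x. W (v x s)) z\<bar> \<le> 2 * F 0 * (Lw * e)"
    by (rule dav_diff_bound[OF blip_W[of "\<lambda>x. u x t", OF u] blip_W[of "\<lambda>x. v x s", OF v]])
  then show ?thesis by (simp add: N_def C_def mult_ac)
qed

text \<open>The spatial constant may vary with t, as for \<open>regular\<close> functions: it
  guarantees that the derivative exists, while the modulus in time depends only on C and K.\<close>

lemma N_continuous:
  assumes z: "\<And>t x y. t \<in> I \<Longrightarrow> \<bar>u x t - u y t\<bar> \<le> L t * \<bar>x - y\<bar>"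
    and t: "\<And>s t x. s \<in> I \<Longrightarrow> t \<in> I \<Longrightarrow> \<bar>u x s - u x t\<bar> \<le> K * \<bar>s - t\<bar>" and K: "0 \<le> K"
  shows "continuous_on I (\<lambda>s. N u s z)"
proof -
  have "(C * K)-lipschitz_on I (\<lambda>s. N u s z)"
  proof (rule lipschitz_onI)
    fix r s assume rs: "r \<in> I" "s \<in> I"
    have "\<bar>N u r z - N u s z\<bar> \<le> C * (K * \<bar>r - s\<bar>)"
      by (rule N_diff[of u r "L r" u s "L s"]) (use z t rs in auto)
    then show "dist (N u r z) (N u s z) \<le> C * K * dist r s"
      by (simp add: dist_real_def)
  qed (use K C_nonneg in simp)
  then show ?thesis by (rule lipschitz_on_continuous_on)
qed

definition mild :: "real \<Rightarrow> (real \<Rightarrow> real \<Rightarrow> real) \<Rightarrow> bool" where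
  "mild T u \<longleftrightarrow> (\<forall>z. \<forall>t\<in>{0..T}. u z t = u z 0 + integral {0..t} (\<lambda>s. N u s z))"

lemma N_continuous_lip_on:
  assumes "lip_on L T u"
  shows "continuous_on {0..T} (\<lambda>s. N u s z)"
proof (cases "0 \<le> T")
  case True
  show ?thesis
  proof (rule N_continuous[where L="\<lambda>_. L" and K=L])
    show "\<bar>u x t - u y t\<bar> \<le> L * \<bar>x - y\<bar>" if "t \<in> {0..T}" for t x y
      using lip_onD[OF assms that that, of x y] by simp
    show "\<bar>u x s - u x t\<bar> \<le> L * \<bar>s - t\<bar>" if "s \<in> {0..T}" "t \<in> {0..T}" for s t x
      using lip_onD[OF assms that, of x x] by simp
  qed (rule lip_on_nonneg[OF assms True])
qed auto

text \<open>Each use of the integrated equation halves the weighted distance of u and v; infinitely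
  many halvings leave zero.\<close>

lemma mild_unique:
  assumes u: "lip_on L T u" and v: "lip_on L' T v" and mu: "mild T u" and mv: "mild T v"
    and eq: "\<And>z. u z 0 = v z 0" and t: "t \<in> {0..T}"
  shows "u z t = v z t"
proof -
  define a where "a = C + 1"
  \<comment> \<open>Starting bound for the halving: u and v may be unbounded, but both are Lipschitz
    in time and start from the same values.\<close>
  define K where "K = (L + L') * T"
  have a: "0 < a" "C \<le> a" using C_nonneg by (auto simp: a_def)
  have T: "0 \<le> T" using t by simp
  have L: "0 \<le> L" "0 \<le> L'" using lip_on_nonneg u v T by auto
  then have K: "0 \<le> K" using T by (simp add: K_def)
  have est: "\<bar>u z t - v z t\<bar> \<le> K / 2 ^ n * exp (2 * a * t)" if "t \<in> {0..T}" for n z t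
    using that
  proof (induction n arbitrary: z t)
    case 0
    have "\<bar>u z t - u z 0\<bar> \<le> L * (\<bar>z - z\<bar> + \<bar>t - 0\<bar>)" "\<bar>v z t - v z 0\<bar> \<le> L' * (\<bar>z - z\<bar> + \<bar>t - 0\<bar>)"
      using 0 by (intro lip_onD[OF u] lip_onD[OF v]; simp)+
    moreover have "L * t \<le> L * T" "L' * t \<le> L' * T" using 0 L by (auto intro: mult_left_mono)
    ultimately have "\<bar>u z t - v z t\<bar> \<le> K"
      using eq[of z] 0 by (simp add: K_def algebra_simps)
    also have "K * 1 \<le> K * exp (2 * a * t)" using K a 0 by (intro mult_left_mono) auto
    finally show ?case by simp
  next
    case (Suc n)
    have sub: "{0..t} \<subseteq> {0..T}" using Suc.prems by auto
    have "\<bar>integral {0..t} (\<lambda>s. N u s z) - integral {0..t} (\<lambda>s. N v s z)\<bar> \<le> (K / 2 ^ n) / 2 * exp (2 * a * t)"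
    proof (rule integral_diff_exp_bound)
      fix s assume s: "s \<in> {0..t}"
      have "\<bar>N u s z - N v s z\<bar> \<le> C * (K / 2 ^ n * exp (2 * a * s))"
        using lip_onD[OF u, of s s] lip_onD[OF v, of s s] s sub
        by (intro N_diff[where L=L and L'=L'] Suc.IH) auto
      also have "\<dots> \<le> a * (K / 2 ^ n * exp (2 * a * s))"
        using a K by (intro mult_right_mono) auto
      finally show "\<bar>N u s z - N v s z\<bar> \<le> a * (K / 2 ^ n * exp (2 * a * s))" .
    qed (use Suc.prems K continuous_on_subset[OF N_continuous_lip_on sub] u v in auto)
    moreover have "u z t - v z t = integral {0..t} (\<lambda>s. N u s z) - integral {0..t} (\<lambda>s. N v s z)"
      using mu mv eq Suc.prems unfolding mild_def by (metis add_diff_cancel_left)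
    ultimately show ?case by (simp add: mult.commute)
  qed
  have "(\<lambda>n. K * exp (2 * a * t) * (1 / 2) ^ n) \<longlonglongrightarrow> K * exp (2 * a * t) * 0"
    by (intro tendsto_intros LIMSEQ_realpow_zero) auto
  moreover have "\<bar>u z t - v z t\<bar> \<le> K * exp (2 * a * t) * (1 / 2) ^ n" for n
    using est[OF t, of z n] by (simp add: power_one_over field_simps)
  ultimately have "\<bar>u z t - v z t\<bar> \<le> 0"
    by (intro LIMSEQ_le_const[of "\<lambda>n. K * exp (2 * a * t) * (1 / 2) ^ n"]) auto
  then show ?thesis by simp
qed

section \<open>Global existence by Picard iteration\<close>

primrec picard :: "(real \<Rightarrow> real) \<Rightarrow> nat \<Rightarrow> real \<Rightarrow> real \<Rightarrow> real" where
  "picard a 0 = (\<lambda>z t. a z)"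
| "picard a (Suc k) = (\<lambda>z t. a z + integral {0..t} (\<lambda>s. N (picard a k) s z))"

text \<open>These are the bounds that a Picard step reproduces without loss. The spatial Lipschitz
  constant obeys l' = C l, whose solution is L exp(C t), and the time constant is the supremum bound
  of \<open>N\<close>. Being uniform over the iterates, they survive in the limit.\<close>

definition regular :: "real \<Rightarrow> (real \<Rightarrow> real \<Rightarrow> real) \<Rightarrow> bool" where
  "regular L u \<longleftrightarrow> (\<forall>t\<ge>0. \<forall>x y. \<bar>u x t - u y t\<bar> \<le> L * exp (C * t) * \<bar>x - y\<bar>)
    \<and> (\<forall>s\<ge>0. \<forall>t\<ge>0. \<forall>x. \<bar>u x s - u x t\<bar> \<le> 2 * F 0 * Bw * \<bar>s - t\<bar>)"

lemma regular_space: "regular L u \<Longrightarrow> 0 \<le> t \<Longrightarrow> \<bar>u x t - u y t\<bar> \<le> L * exp (C * t) * \<bar>x - y\<bar>"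
  by (simp add: regular_def)

lemma regular_time: "regular L u \<Longrightarrow> 0 \<le> s \<Longrightarrow> 0 \<le> t \<Longrightarrow> \<bar>u x s - u x t\<bar> \<le> 2 * F 0 * Bw * \<bar>s - t\<bar>"
  by (simp add: regular_def)

lemma regular_N_continuous:
  assumes "regular L u" "I \<subseteq> {0..}"
  shows "continuous_on I (\<lambda>s. N u s z)"
  by (rule N_continuous[where L="\<lambda>t. L * exp (C * t)" and K="2 * F 0 * Bw"])
    (use regular_space[OF assms(1)] regular_time[OF assms(1)] assms(2) F_nonneg Bw_nonneg in
      \<open>auto simp: subset_iff\<close>)

lemma regular_step:
  assumes u: "regular L u" and a: "\<And>x y. \<bar>a x - a y\<bar> \<le> L * \<bar>x - y\<bar>"
  shows "regular L (\<lambda>z t. a z + integral {0..t} (\<lambda>s. N u s z))"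
proof -
  note cont = regular_N_continuous[OF u]
  have L: "0 \<le> L" using a[of 1 0] by simp
  have int: "(\<lambda>s. N u s z) integrable_on {s..t}" if "0 \<le> s" for s t z
    using that by (intro integrable_continuous_real cont) auto
  have "\<bar>(a x + integral {0..t} (\<lambda>s. N u s x)) - (a y + integral {0..t} (\<lambda>s. N u s y))\<bar>
      \<le> L * exp (C * t) * \<bar>x - y\<bar>" if t: "t \<ge> 0" for t x y
  proof -
    \<comment> \<open>The accumulated constant is L exp(C t) - L, which leaves exactly the room
      taken by the initial datum.\<close>
    have e: "((\<lambda>s. C * (L * exp (C * s)) * \<bar>x - y\<bar>) has_integral
        L * exp (C * t) * \<bar>x - y\<bar> - L * exp (C * 0) * \<bar>x - y\<bar>) {0..t}"
      using t by (intro fundamental_theorem_of_calculus)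
        (auto simp flip: has_real_derivative_iff_has_vector_derivative intro!: derivative_eq_intros)
    have "norm (integral {0..t} (\<lambda>s. N u s x - N u s y))
        \<le> integral {0..t} (\<lambda>s. C * (L * exp (C * s)) * \<bar>x - y\<bar>)"
      by (rule integral_norm_bound_integral)
        (use e N_lip[OF regular_space[OF u]] in
          \<open>auto intro!: integrable_continuous_real continuous_intros cont\<close>)
    then have "\<bar>integral {0..t} (\<lambda>s. N u s x) - integral {0..t} (\<lambda>s. N u s y)\<bar>
        \<le> L * exp (C * t) * \<bar>x - y\<bar> - L * \<bar>x - y\<bar>"
      using int[of 0] unfolding integral_unique[OF e] by (simp add: integral_diff)
    then show ?thesis using a[of x y] by linarith
  qed
  moreover have *: "\<bar>integral {0..t} (\<lambda>s. N u s x) - integral {0..s} (\<lambda>s. N u s x)\<bar> \<le> 2 * F 0 * Bw * \<bar>s - t\<bar>"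
    if st: "0 \<le> s" "s \<le> t" for s t x
  proof -
    have "integral {0..t} (\<lambda>s. N u s x) - integral {0..s} (\<lambda>s. N u s x) = integral {s..t} (\<lambda>s. N u s x)"
      using Henstock_Kurzweil_Integration.integral_combine[of 0 s t "\<lambda>s. N u s x"] st int[of 0] by simp
    also have "norm \<dots> \<le> 2 * F 0 * Bw * (t - s)"
      using st by (intro integral_bound cont) (auto intro!: N_bound[OF regular_space[OF u]])
    finally show ?thesis using st by simp
  qed
  moreover have "\<bar>integral {0..s} (\<lambda>s. N u s x) - integral {0..t} (\<lambda>s. N u s x)\<bar> \<le> 2 * F 0 * Bw * \<bar>s - t\<bar>"
    if "0 \<le> s" "0 \<le> t" for s t x
    using *[of s t x] *[of t s x] that by (cases "s \<le> t") (auto simp: abs_minus_commute)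
  ultimately show ?thesis by (simp add: regular_def)
qed

lemma regular_picard:
  assumes a: "\<And>x y. \<bar>a x - a y\<bar> \<le> L * \<bar>x - y\<bar>"
  shows "regular L (picard a k)"
proof (induction k)
  case 0
  have "\<bar>a x - a y\<bar> \<le> L * exp (C * t) * \<bar>x - y\<bar>" if "t \<ge> 0" for x y t
  proof -
    have "L * 1 \<le> L * exp (C * t)"
      using a[of 1 0] C_nonneg that by (intro mult_left_mono) auto
    then show ?thesis using a[of x y] mult_right_mono[of L "L * exp (C * t)" "\<bar>x - y\<bar>"] by simp
  qed
  then show ?case using F_nonneg Bw_nonneg by (simp add: regular_def)
next
  case (Suc k)
  then show ?case using regular_step[OF _ a] by simp
qed

theorem mild_solution_exists:
  assumes a: "\<And>x y. \<bar>a x - a y\<bar> \<le> L * \<bar>x - y\<bar>"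
  shows "\<exists>u. regular L u \<and> (\<forall>z. u z 0 = a z) \<and> (\<forall>z. \<forall>t\<ge>0. u z t = a z + integral {0..t} (\<lambda>s. N u s z))"
proof -
  define K where "K = 2 * F 0 * Bw"
  \<comment> \<open>Besides dominating C, the exponent is at least 1, so that t <= 1 + 2 b t <=
    exp(2 b t) starts the induction for \<open>est\<close>.\<close>
  define b where "b = C + 1"
  let ?P = "picard a"
  note reg = regular_picard[OF a]
  have K: "0 \<le> K" using F_nonneg Bw_nonneg by (simp add: K_def)
  have b: "1 \<le> b" "C \<le> b" using C_nonneg by (auto simp: b_def)
  have Nd: "\<bar>N u s z - N v s z\<bar> \<le> b * (A * exp (2 * b * s))"
    if "regular L u" "regular L v" "0 \<le> s" "0 \<le> A" "\<And>x. \<bar>u x s - v x s\<bar> \<le> A * exp (2 * b * s)" for u v s z A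
  proof -
    have "\<bar>N u s z - N v s z\<bar> \<le> C * (A * exp (2 * b * s))"
      by (rule N_diff[of u s "L * exp (C * s)" v s "L * exp (C * s)"])
        (use regular_space[OF that(1,3)] regular_space[OF that(2,3)] that(5) in auto)
    also have "\<dots> \<le> b * (A * exp (2 * b * s))" using b that by (intro mult_right_mono) auto
    finally show ?thesis .
  qed
  have est: "\<bar>?P (Suc k) z t - ?P k z t\<bar> \<le> K / 2 ^ k * exp (2 * b * t)" if "0 \<le> t" for k z t
    using that
  proof (induction k arbitrary: z t)
    case 0
    have "\<bar>?P (Suc 0) z t - ?P (Suc 0) z 0\<bar> \<le> K * \<bar>t - 0\<bar>"
      unfolding K_def by (intro regular_time[OF reg]) (use 0 in auto)
    also have "\<dots> \<le> K * exp (2 * b * t)"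
    proof (rule mult_left_mono[OF _ K])
      have "\<bar>t - 0\<bar> \<le> 1 + 2 * b * t" using 0 b mult_right_mono[of 1 b t] by simp
      then show "\<bar>t - 0\<bar> \<le> exp (2 * b * t)" using exp_ge_add_one_self[of "2 * b * t"] by linarith
    qed
    finally show ?case by simp
  next
    case (Suc k)
    have "\<bar>integral {0..t} (\<lambda>s. N (?P (Suc k)) s z) - integral {0..t} (\<lambda>s. N (?P k) s z)\<bar>
        \<le> (K / 2 ^ k) / 2 * exp (2 * b * t)"
      using Suc K by (intro integral_diff_exp_bound regular_N_continuous[OF reg] Nd reg) auto
    then show ?case by (simp add: mult.commute)
  qed
  define u where "u z t = lim (\<lambda>k. ?P k z t)" for z t
  have lim: "(\<lambda>k. ?P k z t) \<longlonglongrightarrow> u z t"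
    and rate: "\<bar>u z t - ?P k z t\<bar> \<le> 2 * K / 2 ^ k * exp (2 * b * t)" if t: "0 \<le> t" for z t k
  proof -
    define E where "E = K * exp (2 * b * t)"
    have le: "norm (?P (Suc k) z t - ?P k z t) \<le> E * (1/2) ^ k" for k
      using est[OF t, of k z] by (simp add: E_def power_one_over field_simps)
    have geo: "(\<lambda>i. E * (1/2) ^ k * (1/2) ^ i) sums (2 * E * (1 / 2) ^ k)" for k
      using sums_mult[OF geometric_sums[of "1/2::real"], of "E * (1/2) ^ k"] by (simp add: mult_ac)
    have "summable (\<lambda>i. ?P (Suc i) z t - ?P i z t)"
      by (rule summable_comparison_test'[OF sums_summable[OF geo[of 0]], of 0]) (use le in simp)
    then have "convergent (\<lambda>k. ?P k z t)"
      unfolding summable_iff_convergent sum_lessThan_telescope[of "\<lambda>k. ?P k z t"]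
      using convergent_add_const_iff[of "- ?P 0 z t" "\<lambda>k. ?P k z t"] by simp
    then show l: "(\<lambda>k. ?P k z t) \<longlonglongrightarrow> u z t" unfolding u_def by (simp add: convergent_LIMSEQ_iff)
    have s: "(\<lambda>i. ?P (Suc (i + k)) z t - ?P (i + k) z t) sums (u z t - ?P (0 + k) z t)"
      using telescope_sums[of "\<lambda>i. ?P (i + k) z t" "u z t"] LIMSEQ_ignore_initial_segment[OF l, of k]
      by simp
    have "norm (u z t - ?P (0 + k) z t) \<le> 2 * E * (1 / 2) ^ k"
    proof (rule norm_sums_le[OF s geo[of k]])
      show "norm (?P (Suc (i + k)) z t - ?P (i + k) z t) \<le> E * (1 / 2) ^ k * (1 / 2) ^ i" for i
        using le[of "i + k"] by (simp only: power_add mult_ac)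
    qed
    then show "\<bar>u z t - ?P k z t\<bar> \<le> 2 * K / 2 ^ k * exp (2 * b * t)"
      by (simp add: E_def power_one_over field_simps)
  qed
  have u_reg: "regular L u"
    unfolding regular_def
  proof (intro conjI allI impI)
    show "\<bar>u x t - u y t\<bar> \<le> L * exp (C * t) * \<bar>x - y\<bar>" if "0 \<le> t" for t x y
      by (rule LIMSEQ_le_const2[OF tendsto_rabs[OF tendsto_diff[OF lim lim]]])
        (use that regular_space[OF reg] in auto)
    show "\<bar>u x s - u x t\<bar> \<le> 2 * F 0 * Bw * \<bar>s - t\<bar>" if "0 \<le> s" "0 \<le> t" for s t x
      by (rule LIMSEQ_le_const2[OF tendsto_rabs[OF tendsto_diff[OF lim lim]]])
        (use that regular_time[OF reg] in auto)
  qed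
  have u_eq: "u z t = a z + integral {0..t} (\<lambda>s. N u s z)" if t: "0 \<le> t" for z t
  proof -
    \<comment> \<open>The convergence rate of the iterates already has the weighted form, so the
      halving estimate also carries the limit through the integral.\<close>
    have "\<bar>integral {0..t} (\<lambda>s. N (?P k) s z) - integral {0..t} (\<lambda>s. N u s z)\<bar>
        \<le> (2 * K / 2 ^ k) / 2 * exp (2 * b * t)" for k
    proof (rule integral_diff_exp_bound)
      fix s assume "s \<in> {0..t}"
      then show "\<bar>N (?P k) s z - N u s z\<bar> \<le> b * (2 * K / 2 ^ k * exp (2 * b * s))"
        using K rate by (intro Nd[OF reg u_reg]) (auto simp: abs_minus_commute)
    qed (use t K in \<open>auto intro: regular_N_continuous[OF reg] regular_N_continuous[OF u_reg]\<close>)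
    moreover have "(2 * K / 2 ^ k) / 2 * exp (2 * b * t) = K * exp (2 * b * t) * (1 / 2) ^ k" for k
      by (simp add: power_one_over)
    ultimately have "\<bar>?P (Suc k) z t - (a z + integral {0..t} (\<lambda>s. N u s z))\<bar> \<le> K * exp (2 * b * t) * (1 / 2) ^ k" for k
      by simp
    then have ev: "\<forall>\<^sub>F k in sequentially. norm (?P (Suc k) z t - (a z + integral {0..t} (\<lambda>s. N u s z)))
        \<le> K * exp (2 * b * t) * (1 / 2) ^ k"
      by (intro always_eventually allI) (simp only: real_norm_def)
    have "(\<lambda>k. K * exp (2 * b * t) * (1 / 2) ^ k) \<longlonglongrightarrow> 0"
      by (intro tendsto_mult_right_zero LIMSEQ_realpow_zero) auto
    then have "(\<lambda>k. ?P (Suc k) z t - (a z + integral {0..t} (\<lambda>s. N u s z))) \<longlonglongrightarrow> 0"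
      by (rule Lim_null_comparison[OF ev])
    then have "(\<lambda>k. ?P (Suc k) z t) \<longlonglongrightarrow> a z + integral {0..t} (\<lambda>s. N u s z)"
      by (rule LIM_zero_cancel)
    then show ?thesis
      by (rule LIMSEQ_unique[OF LIMSEQ_Suc[OF lim[OF t]]])
  qed
  moreover have "u z 0 = a z" for z by (subst u_eq) auto
  ultimately show ?thesis using u_reg by blast
qed

lemma regular_lip_on:
  assumes "regular L u" "0 \<le> L" "0 \<le> T"
  shows "lip_on (L * exp (C * T) + 2 * F 0 * Bw) T u"
proof (rule lip_onI)
  show "\<bar>u x t - u y t\<bar> \<le> L * exp (C * T) * \<bar>x - y\<bar>" if t: "t \<in> {0..T}" for x y t
  proof -
    have "\<bar>u x t - u y t\<bar> \<le> L * exp (C * t) * \<bar>x - y\<bar>"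
      using t by (intro regular_space[OF assms(1)]) auto
    also have "\<dots> \<le> L * exp (C * T) * \<bar>x - y\<bar>"
      using t assms C_nonneg by (intro mult_right_mono mult_left_mono) (auto intro: mult_left_mono)
    finally show ?thesis .
  qed
  show "\<bar>u x s - u x t\<bar> \<le> 2 * F 0 * Bw * \<bar>s - t\<bar>" if "s \<in> {0..T}" "t \<in> {0..T}" for x s t
    using that by (intro regular_time[OF assms(1)]) auto
qed (use assms F_nonneg Bw_nonneg in auto)

end

section \<open>Weak and mild solutions\<close>

lemma Cinf_continuous:
  assumes "Cinf f" shows "continuous_on A f"
  using assms
proof cases
  case (1 fz ft)
  then show ?thesis
    by (meson continuous_at_imp_continuous_on has_derivative_continuous)
qed

lemma test_funE:
  assumes "test_fun T \<phi>" and T: "0 < T"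
  obtains R \<phi>z \<phi>t where "0 < R" "continuous_on UNIV \<phi>" "continuous_on UNIV \<phi>z" "continuous_on UNIV \<phi>t"
    and "\<And>z t. ((\<lambda>s. \<phi> (z, s)) has_real_derivative \<phi>t (z, t)) (at t)"
    and "\<And>z t. ((\<lambda>s. \<phi> (s, t)) has_real_derivative \<phi>z (z, t)) (at z)"
    and "\<And>z t. t \<in> {0..T} \<Longrightarrow> R \<le> \<bar>z\<bar> \<Longrightarrow> \<phi> (z, t) = 0"
    and "\<And>z t. t \<in> {0..T} \<Longrightarrow> R \<le> \<bar>z\<bar> \<Longrightarrow> \<phi>z (z, t) = 0"
    and "\<And>z t. t \<in> {0..T} \<Longrightarrow> R \<le> \<bar>z\<bar> \<Longrightarrow> \<phi>t (z, t) = 0"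
proof -
  have c: "Cinf \<phi>" using assms by (simp add: test_fun_def)
  obtain R0 where R0: "\<And>z t. t \<in> {0..T} \<Longrightarrow> R0 < \<bar>z\<bar> \<Longrightarrow> \<phi> (z, t) = 0"
    using assms by (auto simp: test_fun_def)
  \<comment> \<open>The enlargement gives every z with R <= |z| a whole neighbourhood on which the
    test function vanishes, hence a zero spatial derivative there.\<close>
  define R where "R = max R0 0 + 1"
  from c obtain \<phi>z \<phi>t where d: "\<And>x. (\<phi> has_derivative (\<lambda>h. fst h * \<phi>z x + snd h * \<phi>t x)) (at x)"
    and cz: "Cinf \<phi>z" and ct: "Cinf \<phi>t" by cases auto
  have dt: "((\<lambda>s. \<phi> (z, s)) has_real_derivative \<phi>t (z, t)) (at t)" for z t
  proof -
    have "((\<lambda>s. (z, s)) has_derivative (\<lambda>h. (0, h))) (at t)"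
      by (intro derivative_intros)
    from has_derivative_compose[OF this d] show ?thesis
      by (simp add: has_field_derivative_def mult_commute_abs)
  qed
  have dz: "((\<lambda>s. \<phi> (s, t)) has_real_derivative \<phi>z (z, t)) (at z)" for z t
  proof -
    have "((\<lambda>s. (s, t)) has_derivative (\<lambda>h. (h, 0))) (at z)"
      by (intro derivative_intros)
    from has_derivative_compose[OF this d] show ?thesis
      by (simp add: has_field_derivative_def mult_commute_abs)
  qed
  have z0: "\<phi>z (z, t) = 0" if t: "t \<in> {0..T}" and z: "R \<le> \<bar>z\<bar>" for z t
  proof -
    have "((\<lambda>s. 0) has_real_derivative \<phi>z (z, t)) (at z)"
      by (rule has_field_derivative_transform_within_open[OF dz, where S="- {-R0..R0}"])
        (use z R0[OF t] in \<open>auto simp: R_def\<close>)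
    then show ?thesis using DERIV_unique DERIV_const by blast
  qed
  \<comment> \<open>The test function is known to vanish only for times in [0, T], so at t = 0 and t
    = T the derivative is identified from within the interval, which is nondegenerate because 0 <
    T.\<close>
  have t0: "\<phi>t (z, t) = 0" if t: "t \<in> {0..T}" and z: "R \<le> \<bar>z\<bar>" for z t
  proof -
    have "((\<lambda>s. \<phi> (z, s)) has_real_derivative \<phi>t (z, t)) (at t within {0..T})"
      using dt by (rule has_field_derivative_at_within)
    then have "((\<lambda>s. 0) has_real_derivative \<phi>t (z, t)) (at t within {0..T})"
      by (rule has_field_derivative_transform_within[where d=1]) (use t z R0 in \<open>auto simp: R_def\<close>)
    then show ?thesis
      using vector_derivative_unique_within_closed_interval[of 0 T t "\<lambda>s. 0" "\<phi>t (z, t)" 0] T t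
      by (auto simp: has_real_derivative_iff_has_vector_derivative)
  qed
  show thesis
    by (rule that[of R \<phi>z \<phi>t]) (use dt dz z0 t0 R0 c cz ct in \<open>auto simp: R_def Cinf_continuous\<close>)
qed

text \<open>The weak formulation uses Lebesgue integrals; the fundamental theorem and the
  interchange of integrals are applied to gauge integrals. For continuous integrands with compact
  support the two agree.\<close>

lemma lint_eq_integral_compact_support:
  fixes f :: "real \<Rightarrow> real"
  assumes "continuous_on {a..b} f" and "\<And>x. x \<notin> {a..b} \<Longrightarrow> f x = 0"
  shows "(LINT x|lborel. f x) = integral {a..b} f"
proof -
  have "(LINT x|lborel. f x) = (LINT x:{a..b}|lborel. f x)"
    unfolding set_lebesgue_integral_def
  proof (intro Bochner_Integration.integral_cong refl)
    show "f x = indicator {a..b} x *\<^sub>R f x" for x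
      using assms(2)[of x] by (cases "x \<in> {a..b}") auto
  qed
  also have "\<dots> = integral {a..b} f"
    by (intro set_borel_integral_eq_integral borel_integrable_atLeastAtMost' assms)
  finally show ?thesis .
qed

lemma continuous_on_slice:
  fixes g :: "real \<Rightarrow> real \<Rightarrow> real"
  assumes "continuous_on (UNIV \<times> {0..T}) (\<lambda>x. g (fst x) (snd x))"
  shows "t \<in> {0..T} \<Longrightarrow> continuous_on A (\<lambda>z. g z t)"
    and "continuous_on {0..T} (\<lambda>t. g z t)"
proof -
  show "continuous_on A (\<lambda>z. g z t)" if "t \<in> {0..T}"
    using that by (intro continuous_on_compose2[OF assms, of A "\<lambda>z. (z, t)", simplified]) (auto intro!: continuous_intros)
  show "continuous_on {0..T} (\<lambda>t. g z t)"
    by (intro continuous_on_compose2[OF assms, of "{0..T}" "\<lambda>t. (z, t)", simplified]) (auto intro!: continuous_intros)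
qed

lemma continuous_on_integral_slice:
  fixes g :: "real \<Rightarrow> real \<Rightarrow> real"
  assumes "continuous_on (UNIV \<times> {0..T}) (\<lambda>x. g (fst x) (snd x))"
  shows "continuous_on {0..T} (\<lambda>t. integral {a..b} (\<lambda>z. g z t))"
proof -
  have "continuous_on ({0..T} \<times> cbox a b) (\<lambda>(t, z). g z t)"
    unfolding case_prod_unfold
    by (intro continuous_on_compose2[OF assms, of _ "\<lambda>x. (snd x, fst x)", simplified])
      (auto intro!: continuous_intros)
  from integral_continuous_on_param[OF this] show ?thesis by simp
qed

lemma lint_strip_eq_integral:
  fixes g :: "real \<Rightarrow> real \<Rightarrow> real"
  assumes g: "continuous_on (UNIV \<times> {0..T}) (\<lambda>x. g (fst x) (snd x))"
    and z: "\<And>z t. t \<in> {0..T} \<Longrightarrow> R \<le> \<bar>z\<bar> \<Longrightarrow> g z t = 0"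
  shows "(LINT t:{0..T}|lborel. LINT z|lborel. g z t) = integral {0..T} (\<lambda>t. integral {-R..R} (\<lambda>z. g z t))"
proof -
  have "(LINT t:{0..T}|lborel. LINT z|lborel. g z t) = (LINT t:{0..T}|lborel. integral {-R..R} (\<lambda>z. g z t))"
    by (intro set_lebesgue_integral_cong)
      (auto intro!: lint_eq_integral_compact_support continuous_on_slice[OF g] z)
  also have "\<dots> = integral {0..T} (\<lambda>t. integral {-R..R} (\<lambda>z. g z t))"
    by (intro set_borel_integral_eq_integral borel_integrable_atLeastAtMost' continuous_on_integral_slice g)
  finally show ?thesis .
qed

text \<open>With \<open>d\<close> a common value of \<open>\<partial>\<^sub>t m\<close> and \<open>\<partial>\<^sub>z A\<close>, both sides equal the integral of
  \<open>\<partial>\<^sub>t (m \<phi>)\<close> over the strip.\<close>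

lemma weak_identity:
  fixes m A d :: "real \<Rightarrow> real \<Rightarrow> real" and \<phi> \<phi>z \<phi>t :: "real \<times> real \<Rightarrow> real"
  assumes T: "0 \<le> T" and R: "0 \<le> R"
    and cm: "continuous_on (UNIV \<times> {0..T}) (\<lambda>x. m (fst x) (snd x))"
    and cA: "continuous_on (UNIV \<times> {0..T}) (\<lambda>x. A (fst x) (snd x))"
    and cd: "continuous_on (UNIV \<times> {0..T}) (\<lambda>x. d (fst x) (snd x))"
    and dm: "\<And>z t. t \<in> {0..T} \<Longrightarrow> ((\<lambda>s. m z s) has_real_derivative d z t) (at t within {0..T})"
    and dA: "\<And>z t. t \<in> {0..T} \<Longrightarrow> ((\<lambda>s. A s t) has_real_derivative d z t) (at z)"
    and c\<phi>: "continuous_on UNIV \<phi>" "continuous_on UNIV \<phi>z" "continuous_on UNIV \<phi>t"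
    and d\<phi>t: "\<And>z t. ((\<lambda>s. \<phi> (z, s)) has_real_derivative \<phi>t (z, t)) (at t)"
    and d\<phi>z: "\<And>z t. ((\<lambda>s. \<phi> (s, t)) has_real_derivative \<phi>z (z, t)) (at z)"
    and \<phi>0: "\<And>z t. t \<in> {0..T} \<Longrightarrow> R \<le> \<bar>z\<bar> \<Longrightarrow> \<phi> (z, t) = 0"
  shows "integral {0..T} (\<lambda>t. integral {-R..R} (\<lambda>z. m z t * \<phi>t (z, t) - A z t * \<phi>z (z, t)))
    = integral {-R..R} (\<lambda>z. m z T * \<phi> (z, T) - m z 0 * \<phi> (z, 0))"
proof -
  have c\<phi>': "continuous_on (UNIV \<times> {0..T}) (\<lambda>x. \<phi> (fst x, snd x))"
    "continuous_on (UNIV \<times> {0..T}) (\<lambda>x. \<phi>z (fst x, snd x))"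
    "continuous_on (UNIV \<times> {0..T}) (\<lambda>x. \<phi>t (fst x, snd x))"
    using c\<phi> by (auto intro: continuous_on_subset)
  note cont = continuous_on_slice[OF cm] continuous_on_slice[OF cA] continuous_on_slice[OF cd]
    continuous_on_slice[of T "\<lambda>z t. \<phi> (z, t)", OF c\<phi>'(1)]
    continuous_on_slice[of T "\<lambda>z t. \<phi>z (z, t)", OF c\<phi>'(2)]
    continuous_on_slice[of T "\<lambda>z t. \<phi>t (z, t)", OF c\<phi>'(3)]
  have space: "integral {-R..R} (\<lambda>z. m z t * \<phi>t (z, t) - A z t * \<phi>z (z, t))
      = integral {-R..R} (\<lambda>z. m z t * \<phi>t (z, t) + d z t * \<phi> (z, t))" if t: "t \<in> {0..T}" for t
  proof -
    \<comment> \<open>The spatial derivative of A \<phi> integrates to zero because \<phi> vanishes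
      at -R and R; adding this zero trades the flux term for d \<phi>.\<close>
    have "((\<lambda>z. d z t * \<phi> (z, t) + \<phi>z (z, t) * A z t) has_integral A R t * \<phi> (R, t) - A (-R) t * \<phi> (-R, t)) {-R..R}"
      using R
      by (intro fundamental_theorem_of_calculus)
        (auto simp flip: has_real_derivative_iff_has_vector_derivative
          intro!: DERIV_mult has_field_derivative_at_within[OF dA[OF t]] has_field_derivative_at_within[OF d\<phi>z])
    then have "integral {-R..R} (\<lambda>z. d z t * \<phi> (z, t) + \<phi>z (z, t) * A z t) = 0"
      using \<phi>0[OF t] by (simp add: integral_unique)
    then have "integral {-R..R} (\<lambda>z. m z t * \<phi>t (z, t) - A z t * \<phi>z (z, t))
        = integral {-R..R} (\<lambda>z. m z t * \<phi>t (z, t) - A z t * \<phi>z (z, t))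
          + integral {-R..R} (\<lambda>z. d z t * \<phi> (z, t) + \<phi>z (z, t) * A z t)" by simp
    also have "\<dots> = integral {-R..R} (\<lambda>z. (m z t * \<phi>t (z, t) - A z t * \<phi>z (z, t))
          + (d z t * \<phi> (z, t) + \<phi>z (z, t) * A z t))"
      using t by (intro integral_add[symmetric] integrable_continuous_real)
        (auto intro!: continuous_intros cont)
    finally show ?thesis by (simp add: algebra_simps)
  qed
  have "integral {0..T} (\<lambda>t. integral {-R..R} (\<lambda>z. m z t * \<phi>t (z, t) - A z t * \<phi>z (z, t)))
      = integral {0..T} (\<lambda>t. integral {-R..R} (\<lambda>z. m z t * \<phi>t (z, t) + d z t * \<phi> (z, t)))"
    by (rule integral_cong) (rule space)
  also have "\<dots> = integral {-R..R} (\<lambda>z. integral {0..T} (\<lambda>t. m z t * \<phi>t (z, t) + d z t * \<phi> (z, t)))"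
  proof -
    have g: "continuous_on (UNIV \<times> {0..T}) (\<lambda>x. m (fst x) (snd x) * \<phi>t (fst x, snd x) + d (fst x) (snd x) * \<phi> (fst x, snd x))"
      by (intro continuous_intros cm cd c\<phi>')
    have "continuous_on (cbox (0, -R) (T, R)) (\<lambda>(t, z). m z t * \<phi>t (z, t) + d z t * \<phi> (z, t))"
      unfolding case_prod_unfold
      by (rule continuous_on_compose2[OF g, where f="\<lambda>x. (snd x, fst x)", simplified])
        (auto intro!: continuous_intros simp: cbox_Pair_eq)
    from integral_swap_continuous[OF this] show ?thesis by simp
  qed
  also have "\<dots> = integral {-R..R} (\<lambda>z. m z T * \<phi> (z, T) - m z 0 * \<phi> (z, 0))"
  proof (intro integral_cong integral_unique)
    fix z
    have "((\<lambda>t. d z t * \<phi> (z, t) + \<phi>t (z, t) * m z t) has_integral m z T * \<phi> (z, T) - m z 0 * \<phi> (z, 0)) {0..T}"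
      using T
      by (intro fundamental_theorem_of_calculus)
        (auto simp flip: has_real_derivative_iff_has_vector_derivative
          intro!: DERIV_mult dm has_field_derivative_at_within[OF d\<phi>t])
    then show "((\<lambda>t. m z t * \<phi>t (z, t) + d z t * \<phi> (z, t)) has_integral m z T * \<phi> (z, T) - m z 0 * \<phi> (z, 0)) {0..T}"
      by (simp add: algebra_simps)
  qed
  finally show ?thesis .
qed

section \<open>Equivalence of the weak and the integrated equation\<close>

context nonlocal_flux
begin

definition Aw :: "(real \<Rightarrow> real \<Rightarrow> real) \<Rightarrow> real \<Rightarrow> real \<Rightarrow> real" where
  "Aw u z t = av (\<lambda>x. W (u x t)) z"

text \<open>\<open>weak_sol\<close> for the flux W of the locale; in the application W is the
  extended flux, and the two notions coincide on functions that are at least 1.\<close>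

definition weak :: "real \<Rightarrow> (real \<Rightarrow> real \<Rightarrow> real) \<Rightarrow> bool" where
  "weak T u \<longleftrightarrow> (\<forall>\<phi>. test_fun T \<phi> \<longrightarrow>
     (LINT t:{0..T}|lborel. LINT z|lborel.
         u z t * deriv (\<lambda>s. \<phi> (z, s)) t - Aw u z t * deriv (\<lambda>s. \<phi> (s, t)) z)
     = (LINT z|lborel. u z T * \<phi> (z, T) - u z 0 * \<phi> (z, 0)))"

lemma Aw_has_derivative:
  assumes "lip_on L T u" "t \<in> {0..T}"
  shows "((\<lambda>z. Aw u z t) has_real_derivative N u t z) (at z)"
  using av_has_derivative[OF blip_W[of "\<lambda>x. u x t", OF lip_on_space[OF assms]]]
  by (simp add: Aw_def N_def)

lemma lip_on_Aw:
  assumes u: "lip_on L T u" and T: "0 \<le> T"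
  shows "lip_on (2 * F 0 * Bw + Lw * L) T (Aw u)"
proof (rule lip_onI)
  have b: "blip Bw (Lw * L) (\<lambda>x. W (u x t))" if "t \<in> {0..T}" for t
    using blip_W[of "\<lambda>x. u x t", OF lip_on_space[OF u that]] .
  show "\<bar>Aw u x t - Aw u y t\<bar> \<le> 2 * F 0 * Bw * \<bar>x - y\<bar>" if "t \<in> {0..T}" for x y t
    unfolding Aw_def by (intro av_lipschitz blip_measurable[OF b[OF that]] W_bound)
  show "\<bar>Aw u x s - Aw u x t\<bar> \<le> Lw * L * \<bar>s - t\<bar>" if "s \<in> {0..T}" "t \<in> {0..T}" for x s t
  proof -
    note [measurable] = blip_measurable[OF b[OF that(1)]] blip_measurable[OF b[OF that(2)]]
    have "Aw u x s - Aw u x t = av (\<lambda>y. W (u y s) - W (u y t)) x"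
      unfolding Aw_def by (rule av_diff[symmetric]) (auto intro: W_bound)
    also have "\<bar>\<dots>\<bar> \<le> Lw * (L * \<bar>s - t\<bar>)"
    proof (rule av_bound)
      show "\<bar>W (u y s) - W (u y t)\<bar> \<le> Lw * (L * \<bar>s - t\<bar>)" for y
        using W_lip[of "u y s" "u y t"] mult_left_mono[OF lip_on_time[OF u that, of y] Lw_nonneg]
        by linarith
    qed measurable
    finally show ?thesis by simp
  qed
qed (use F_nonneg Bw_nonneg Lw_nonneg lip_on_nonneg[OF u T] in auto)

lemma lip_on_N:
  assumes u: "lip_on L T u" and T: "0 \<le> T"
  shows "lip_on (C * L + C * L) T (\<lambda>z t. N u t z)"
proof (rule lip_onI)
  show "\<bar>N u t x - N u t y\<bar> \<le> C * L * \<bar>x - y\<bar>" if "t \<in> {0..T}" for x y t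
    by (rule N_lip[of u t, OF lip_on_space[OF u that]])
  show "\<bar>N u s x - N u t x\<bar> \<le> C * L * \<bar>s - t\<bar>" if "s \<in> {0..T}" "t \<in> {0..T}" for x s t
    using N_diff[of u s L u t L "L * \<bar>s - t\<bar>"] lip_on_space[OF u] lip_on_time[OF u] that
    by (simp add: mult.assoc)
qed (use C_nonneg lip_on_nonneg[OF u T] in auto)

text \<open>For every Lipschitz u, solution or not, its time derivative is the space derivative of
  \<open>Aw u\<close>. Being mild means u = \<open>mildify u\<close>, so both directions of the
  equivalence compare these two functions against the same flux.\<close>

definition mildify :: "(real \<Rightarrow> real \<Rightarrow> real) \<Rightarrow> real \<Rightarrow> real \<Rightarrow> real" where
  "mildify u z t = u z 0 + integral {0..t} (\<lambda>s. N u s z)"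

lemma mildify_has_derivative:
  assumes u: "lip_on L T u" and t: "t \<in> {0..T}"
  shows "((\<lambda>t. mildify u z t) has_real_derivative N u t z) (at t within {0..T})"
  unfolding mildify_def
  by (rule DERIV_cong[OF DERIV_add[OF DERIV_const integral_has_real_derivative[OF N_continuous_lip_on[OF u] t]]]) simp

lemma lip_on_mildify:
  assumes u: "lip_on L T u" and T: "0 \<le> T"
  shows "\<exists>K. lip_on K T (mildify u)"
proof -
  have L: "0 \<le> L" by (rule lip_on_nonneg[OF u T])
  have "lip_on ((L + C * L * T) + 2 * F 0 * Bw) T (mildify u)"
  proof (rule lip_onI)
    fix x y t assume t: "t \<in> {0..T}"
    have sub: "{0..t} \<subseteq> {0..T}" using t by auto
    have i: "(\<lambda>s. N u s z) integrable_on {0..t}" for z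
      by (intro integrable_continuous_real continuous_on_subset[OF N_continuous_lip_on[OF u] sub])
    have "integral {0..t} (\<lambda>s. N u s x) - integral {0..t} (\<lambda>s. N u s y) = integral {0..t} (\<lambda>s. N u s x - N u s y)"
      by (simp add: integral_diff i)
    also have "norm \<dots> \<le> (C * L * \<bar>x - y\<bar>) * (t - 0)"
      using t sub
      by (intro integral_bound continuous_intros continuous_on_subset[OF N_continuous_lip_on[OF u] sub])
        (auto intro!: N_lip lip_on_space[OF u])
    also have "\<dots> \<le> (C * L * \<bar>x - y\<bar>) * T"
      using t C_nonneg L by (intro mult_left_mono) auto
    finally show "\<bar>mildify u x t - mildify u y t\<bar> \<le> (L + C * L * T) * \<bar>x - y\<bar>"
      using lip_on_space[OF u, of 0 x y] T by (simp add: mildify_def algebra_simps)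
  next
    fix x s t assume st: "s \<in> {0..T}" "t \<in> {0..T}"
    have "norm (mildify u x s - mildify u x t) \<le> 2 * F 0 * Bw * norm (s - t)"
      by (rule field_differentiable_bound[OF convex_real_interval(5)[of 0 T] mildify_has_derivative[OF u]])
        (use st in \<open>auto intro!: N_bound lip_on_space[OF u]\<close>)
    then show "\<bar>mildify u x s - mildify u x t\<bar> \<le> 2 * F 0 * Bw * \<bar>s - t\<bar>" by simp
  qed (use L C_nonneg T F_nonneg Bw_nonneg in auto)
  then show ?thesis by blast
qed

text \<open>The density v and the function u inside the flux are kept apart because the identity is
  needed for the pair \<open>mildify u\<close> and \<open>Aw u\<close> as well as for u
  alone.\<close>

lemma weak_lhs_eq:
  assumes u: "lip_on L T u" and T: "0 \<le> T" and v: "lip_on L' T v"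
    and c\<phi>: "continuous_on UNIV \<phi>" "continuous_on UNIV \<phi>z" "continuous_on UNIV \<phi>t"
    and d\<phi>t: "\<And>z t. ((\<lambda>s. \<phi> (z, s)) has_real_derivative \<phi>t (z, t)) (at t)"
    and d\<phi>z: "\<And>z t. ((\<lambda>s. \<phi> (s, t)) has_real_derivative \<phi>z (z, t)) (at z)"
    and \<phi>0: "\<And>z t. t \<in> {0..T} \<Longrightarrow> R \<le> \<bar>z\<bar> \<Longrightarrow> \<phi>z (z, t) = 0"
      "\<And>z t. t \<in> {0..T} \<Longrightarrow> R \<le> \<bar>z\<bar> \<Longrightarrow> \<phi>t (z, t) = 0"
  shows "(LINT t:{0..T}|lborel. LINT z|lborel.
      v z t * deriv (\<lambda>s. \<phi> (z, s)) t - Aw u z t * deriv (\<lambda>s. \<phi> (s, t)) z)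
    = integral {0..T} (\<lambda>t. integral {-R..R} (\<lambda>z. v z t * \<phi>t (z, t) - Aw u z t * \<phi>z (z, t)))"
proof -
  have "deriv (\<lambda>s. \<phi> (z, s)) t = \<phi>t (z, t)" "deriv (\<lambda>s. \<phi> (s, t)) z = \<phi>z (z, t)" for z t
    using DERIV_imp_deriv[OF d\<phi>t] DERIV_imp_deriv[OF d\<phi>z] by auto
  moreover have "continuous_on (UNIV \<times> {0..T}) (\<lambda>x. v (fst x) (snd x) * \<phi>t (fst x, snd x) - Aw u (fst x) (snd x) * \<phi>z (fst x, snd x))"
    using c\<phi> by (intro continuous_intros lip_on_continuous[OF v] lip_on_continuous[OF lip_on_Aw[OF u T]])
      (auto intro: continuous_on_subset)
  ultimately show ?thesis
    using lint_strip_eq_integral[where g="\<lambda>z t. v z t * \<phi>t (z, t) - Aw u z t * \<phi>z (z, t)" and R=R and T=T] \<phi>0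
    by simp
qed

lemma mild_iff_mildify: "mild T u \<longleftrightarrow> (\<forall>z. \<forall>t\<in>{0..T}. u z t = mildify u z t)"
  by (simp add: mild_def mildify_def)

lemma mildify_weak:
  assumes u: "lip_on L T u" and T: "0 < T" and \<phi>: "test_fun T \<phi>"
  shows "(LINT t:{0..T}|lborel. LINT z|lborel.
         mildify u z t * deriv (\<lambda>s. \<phi> (z, s)) t - Aw u z t * deriv (\<lambda>s. \<phi> (s, t)) z)
     = (LINT z|lborel. mildify u z T * \<phi> (z, T) - mildify u z 0 * \<phi> (z, 0))"
proof -
  have T0: "0 \<le> T" using T by simp
  obtain K where K: "lip_on K T (mildify u)" using lip_on_mildify[OF u T0] by blast
  obtain R \<phi>z \<phi>t where R: "0 < R" and c: "continuous_on UNIV \<phi>" "continuous_on UNIV \<phi>z" "continuous_on UNIV \<phi>t"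
    and dt: "\<And>z t. ((\<lambda>s. \<phi> (z, s)) has_real_derivative \<phi>t (z, t)) (at t)"
    and dz: "\<And>z t. ((\<lambda>s. \<phi> (s, t)) has_real_derivative \<phi>z (z, t)) (at z)"
    and z0: "\<And>z t. t \<in> {0..T} \<Longrightarrow> R \<le> \<bar>z\<bar> \<Longrightarrow> \<phi> (z, t) = 0"
      "\<And>z t. t \<in> {0..T} \<Longrightarrow> R \<le> \<bar>z\<bar> \<Longrightarrow> \<phi>z (z, t) = 0"
      "\<And>z t. t \<in> {0..T} \<Longrightarrow> R \<le> \<bar>z\<bar> \<Longrightarrow> \<phi>t (z, t) = 0"
    using test_funE[OF \<phi> T] by blast
  have "(LINT t:{0..T}|lborel. LINT z|lborel.
         mildify u z t * deriv (\<lambda>s. \<phi> (z, s)) t - Aw u z t * deriv (\<lambda>s. \<phi> (s, t)) z)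
      = integral {0..T} (\<lambda>t. integral {-R..R} (\<lambda>z. mildify u z t * \<phi>t (z, t) - Aw u z t * \<phi>z (z, t)))"
    by (rule weak_lhs_eq[OF u T0 K c dt dz z0(2,3)])
  also have "\<dots> = integral {-R..R} (\<lambda>z. mildify u z T * \<phi> (z, T) - mildify u z 0 * \<phi> (z, 0))"
    by (rule weak_identity[OF T0 less_imp_le[OF R] lip_on_continuous[OF K]
          lip_on_continuous[OF lip_on_Aw[OF u T0]] lip_on_continuous[OF lip_on_N[OF u T0]]
          mildify_has_derivative[OF u] Aw_has_derivative[OF u] c dt dz z0(1)])
  also have "\<dots> = (LINT z|lborel. mildify u z T * \<phi> (z, T) - mildify u z 0 * \<phi> (z, 0))"
  proof (rule lint_eq_integral_compact_support[symmetric])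
    have "continuous_on A (\<lambda>z. \<phi> (z, t))" for A t
      using c(1) by (rule continuous_on_compose2) (auto intro!: continuous_intros)
    then show "continuous_on {-R..R} (\<lambda>z. mildify u z T * \<phi> (z, T) - mildify u z 0 * \<phi> (z, 0))"
      using T by (auto intro!: continuous_intros continuous_on_slice[OF lip_on_continuous[OF K]])
  qed (use T z0 in auto)
  finally show ?thesis .
qed

lemma mild_imp_weak:
  assumes u: "lip_on L T u" and T: "0 < T" and m: "mild T u"
  shows "weak T u"
  unfolding weak_def
proof (intro allI impI)
  fix \<phi> assume \<phi>: "test_fun T \<phi>"
  have eq: "u z t = mildify u z t" if "t \<in> {0..T}" for z t
    using m that by (auto simp: mild_iff_mildify)
  have "(LINT t:{0..T}|lborel. LINT z|lborel.
         u z t * deriv (\<lambda>s. \<phi> (z, s)) t - Aw u z t * deriv (\<lambda>s. \<phi> (s, t)) z)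
     = (LINT t:{0..T}|lborel. LINT z|lborel.
         mildify u z t * deriv (\<lambda>s. \<phi> (z, s)) t - Aw u z t * deriv (\<lambda>s. \<phi> (s, t)) z)"
    by (intro set_lebesgue_integral_cong) (simp_all add: eq[symmetric])
  then show "(LINT t:{0..T}|lborel. LINT z|lborel.
         u z t * deriv (\<lambda>s. \<phi> (z, s)) t - Aw u z t * deriv (\<lambda>s. \<phi> (s, t)) z)
     = (LINT z|lborel. u z T * \<phi> (z, T) - u z 0 * \<phi> (z, 0))"
    using mildify_weak[OF u T \<phi>] T eq[of T] eq[of 0] by simp
qed

text \<open>Both u and \<open>mildify u\<close> satisfy the weak identity with the flux
  \<open>Aw u\<close>. In the difference the flux cancels, leaving (u - \<open>mildify u\<close>)
  tested against the time derivative of \<phi>, and bumps in both variables force it to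
  vanish.\<close>

lemma weak_imp_mild:
  assumes u: "lip_on L T u" and T: "0 < T" and w: "weak T u"
  shows "mild T u"
  unfolding mild_iff_mildify
proof safe
  fix z0 t0 :: real assume t0: "t0 \<in> {0..T}"
  have T0: "0 \<le> T" using T by simp
  obtain K where K: "lip_on K T (mildify u)" using lip_on_mildify[OF u T0] by blast
  define G where "G z t = u z t - mildify u z t" for z t
  have cG: "continuous_on (UNIV \<times> {0..T}) (\<lambda>x. G (fst x) (snd x))"
    unfolding G_def by (intro continuous_intros lip_on_continuous[OF u] lip_on_continuous[OF K])
  define R where "R = \<bar>z0\<bar> + 1"
  \<comment> \<open>The two variables are separated: for a fixed bump in space the fundamental lemma
    is applied in time, and afterwards it is applied in space at the fixed time.\<close>
  have "integral {-R..R} (\<lambda>z. G z t * bump c d z) = 0" if cd: "- R < c" "c < d" "d < R" and t: "t \<in> {0..T}" for c d t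
  proof (rule integral_bump_zero_imp_zero[OF _ _ t T])
    have cGb: "continuous_on (UNIV \<times> {0..T}) (\<lambda>x. G (fst x) (snd x) * bump c d (fst x))"
      by (intro continuous_on_mult cG
          continuous_on_compose2[OF continuous_on_bump[of UNIV] continuous_on_fst[OF continuous_on_id]]) simp
    show "continuous_on {0..T} (\<lambda>t. integral {-R..R} (\<lambda>z. G z t * bump c d z))"
      by (rule continuous_on_integral_slice[OF cGb])
    fix p q
    obtain H where H: "\<And>x. (H has_real_derivative bump p q x) (at x)"
      using continuous_imp_antiderivative[OF continuous_on_bump] by blast
    \<comment> \<open>The normalisation at T removes the final-time term, where u and
      \<open>mildify u\<close> are not yet known to agree; at time 0 they agree by
      construction.\<close>
    define \<Theta> where "\<Theta> t = H t - H T" for t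
    have \<Theta>: "(\<Theta> has_real_derivative bump p q t) (at t)" for t
      unfolding \<Theta>_def using DERIV_diff[OF H DERIV_const] by simp
    have s\<Theta>: "smooth1 \<Theta>" by (rule smooth1.antideriv[OF \<Theta> smooth1_bump])
    define \<phi> where "\<phi> x = bump c d (fst x) * \<Theta> (snd x)" for x
    have \<phi>: "test_fun T \<phi>"
      unfolding test_fun_def \<phi>_def using Cinf_tensor[OF smooth1_bump s\<Theta>] cd
      by (auto intro!: exI[of _ R] bump_outside)
    obtain b' where b': "smooth1 b'" "\<And>x. (bump c d has_real_derivative b' x) (at x)"
      using smooth1_deriv[OF smooth1_bump] by blast
    define \<phi>t \<phi>z where "\<phi>t x = bump c d (fst x) * bump p q (snd x)" and "\<phi>z x = b' (fst x) * \<Theta> (snd x)" for x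
    have b'0: "b' z = 0" if z: "R \<le> \<bar>z\<bar>" for z
    proof -
      have "((\<lambda>s. 0) has_real_derivative b' z) (at z)"
        by (rule has_field_derivative_transform_within_open[OF b'(2), where S="- {c..d}"])
          (use cd z in \<open>auto intro: bump_outside\<close>)
      then show ?thesis using DERIV_unique DERIV_const by blast
    qed
    have c: "continuous_on UNIV \<phi>" "continuous_on UNIV \<phi>z" "continuous_on UNIV \<phi>t"
      unfolding \<phi>_def \<phi>t_def \<phi>z_def
      by (intro continuous_on_mult
          continuous_on_compose2[OF smooth1_continuous[OF b'(1), of UNIV] continuous_on_fst[OF continuous_on_id]]
          continuous_on_compose2[OF smooth1_continuous[OF s\<Theta>, of UNIV] continuous_on_snd[OF continuous_on_id]]
          continuous_on_compose2[OF continuous_on_bump[of UNIV] continuous_on_fst[OF continuous_on_id]]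
          continuous_on_compose2[OF continuous_on_bump[of UNIV] continuous_on_snd[OF continuous_on_id]]; simp)+
    have dt: "((\<lambda>s. \<phi> (z, s)) has_real_derivative \<phi>t (z, t)) (at t)" for z t
      unfolding \<phi>_def \<phi>t_def using DERIV_cmult[OF \<Theta>] by simp
    have dz: "((\<lambda>s. \<phi> (s, t)) has_real_derivative \<phi>z (z, t)) (at z)" for z t
      unfolding \<phi>_def \<phi>z_def using DERIV_cmult_right[OF b'(2)] by simp
    have z0: "\<phi>z (z, t) = 0" "\<phi>t (z, t) = 0" if "t \<in> {0..T}" "R \<le> \<bar>z\<bar>" for z t
    proof -
      have "z \<le> c \<or> d \<le> z" using that cd by arith
      then show "\<phi>z (z, t) = 0" "\<phi>t (z, t) = 0"
        using b'0 bump_outside[of z c d] that by (auto simp: \<phi>z_def \<phi>t_def)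
    qed
    note lhs = weak_lhs_eq[OF u T0 _ c dt dz z0]
    have fin: "\<phi> (z, T) = 0" for z by (simp add: \<phi>_def \<Theta>_def)
    have init: "mildify u z 0 = u z 0" for z by (simp add: mildify_def)
    have "integral {0..T} (\<lambda>t. integral {-R..R} (\<lambda>z. u z t * \<phi>t (z, t) - Aw u z t * \<phi>z (z, t)))
        = integral {0..T} (\<lambda>t. integral {-R..R} (\<lambda>z. mildify u z t * \<phi>t (z, t) - Aw u z t * \<phi>z (z, t)))"
      using w[unfolded weak_def, rule_format, OF \<phi>] mildify_weak[OF u T \<phi>] lhs[OF u] lhs[OF K]
      by (simp add: fin init)
    then have "0 = integral {0..T} (\<lambda>t. integral {-R..R} (\<lambda>z. u z t * \<phi>t (z, t) - Aw u z t * \<phi>z (z, t)))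
        - integral {0..T} (\<lambda>t. integral {-R..R} (\<lambda>z. mildify u z t * \<phi>t (z, t) - Aw u z t * \<phi>z (z, t)))"
      by simp
    also have "\<dots> = integral {0..T} (\<lambda>t. integral {-R..R} (\<lambda>z. u z t * \<phi>t (z, t) - Aw u z t * \<phi>z (z, t))
        - integral {-R..R} (\<lambda>z. mildify u z t * \<phi>t (z, t) - Aw u z t * \<phi>z (z, t)))"
    proof (intro integral_diff[symmetric] integrable_continuous_real)
      have g: "continuous_on (UNIV \<times> {0..T}) (\<lambda>x. v (fst x) (snd x) * \<phi>t (fst x, snd x) - Aw u (fst x) (snd x) * \<phi>z (fst x, snd x))"
        if "lip_on L' T v" for v L'
        using c by (intro continuous_intros lip_on_continuous[OF that] lip_on_continuous[OF lip_on_Aw[OF u T0]])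
          (auto intro: continuous_on_subset)
      show "continuous_on {0..T} (\<lambda>t. integral {-R..R} (\<lambda>z. u z t * \<phi>t (z, t) - Aw u z t * \<phi>z (z, t)))"
        by (rule continuous_on_integral_slice[OF g[OF u]])
      show "continuous_on {0..T} (\<lambda>t. integral {-R..R} (\<lambda>z. mildify u z t * \<phi>t (z, t) - Aw u z t * \<phi>z (z, t)))"
        by (rule continuous_on_integral_slice[OF g[OF K]])
    qed
    also have "\<dots> = integral {0..T} (\<lambda>t. integral {-R..R} (\<lambda>z. G z t * bump c d z) * bump p q t)"
    proof (intro integral_cong)
      fix t assume t: "t \<in> {0..T}"
      have cc: "continuous_on A (\<lambda>z. \<phi>t (z, t))" "continuous_on A (\<lambda>z. \<phi>z (z, t))" for A
        by (rule continuous_on_compose2[OF c(3)] continuous_on_compose2[OF c(2)];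
            auto intro!: continuous_intros)+
      have g: "(\<lambda>z. v z t * \<phi>t (z, t) - Aw u z t * \<phi>z (z, t)) integrable_on {-R..R}" if "lip_on L' T v" for v L'
        using t by (intro integrable_continuous_real continuous_intros cc
            continuous_on_slice[OF lip_on_continuous[OF that]]
            continuous_on_slice[OF lip_on_continuous[OF lip_on_Aw[OF u T0]]])
      have "integral {-R..R} (\<lambda>z. u z t * \<phi>t (z, t) - Aw u z t * \<phi>z (z, t))
          - integral {-R..R} (\<lambda>z. mildify u z t * \<phi>t (z, t) - Aw u z t * \<phi>z (z, t))
          = integral {-R..R} (\<lambda>z. (G z t * bump c d z) * bump p q t)"
        unfolding integral_diff[OF g[OF u] g[OF K], symmetric]
        by (simp add: G_def \<phi>t_def algebra_simps)
      then show "integral {-R..R} (\<lambda>z. u z t * \<phi>t (z, t) - Aw u z t * \<phi>z (z, t))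
          - integral {-R..R} (\<lambda>z. mildify u z t * \<phi>t (z, t) - Aw u z t * \<phi>z (z, t))
          = integral {-R..R} (\<lambda>z. G z t * bump c d z) * bump p q t"
        by simp
    qed
    finally show "integral {0..T} (\<lambda>t. integral {-R..R} (\<lambda>z. G z t * bump c d z) * bump p q t) = 0"
      by simp
  qed
  then have "G z0 t0 = 0"
    using t0 by (intro integral_bump_zero_imp_zero[of "-R" R "\<lambda>z. G z t0" z0] continuous_on_slice[OF cG])
      (auto simp: R_def)
  then show "u z0 t0 = mildify u z0 t0" by (simp add: G_def)
qed

end

section \<open>The discrete averages\<close>

lemma integrable_imp_set_integrable:
  fixes f :: "'a \<Rightarrow> 'b::{banach, second_countable_topology}"
  assumes "integrable M f" "A \<in> sets M"
  shows "set_integrable M A f"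
  unfolding set_integrable_def using assms by (rule integrable_mult_indicator[rotated])

lemma set_integrable_bounded_Icc:
  fixes f :: "real \<Rightarrow> real"
  assumes [measurable]: "f \<in> borel_measurable borel" and K: "\<And>x. \<bar>f x\<bar> \<le> K"
  shows "set_integrable lborel {a..b} f"
  unfolding set_integrable_def
proof (rule Bochner_Integration.integrable_bound)
  show "integrable lborel (\<lambda>x. K * indicator {a..b} x)"
    by (intro integrable_mult_right integrable_real_indicator) (auto simp: emeasure_lborel_Icc_eq)
  show "AE x in lborel. norm (indicator {a..b} x *\<^sub>R f x) \<le> norm (K * indicator {a..b} x)"
    using K by (intro AE_I2) (auto simp: indicator_def intro: order_trans[OF _ abs_ge_self])
qed simp

lemma interval_mean_ge:
  fixes f :: "real \<Rightarrow> real"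
  assumes "f \<in> borel_measurable borel" "\<And>x. \<bar>f x\<bar> \<le> K" "\<And>x. k \<le> f x" "a < b"
  shows "k \<le> (1 / (b - a)) * (LINT x:{a..b}|lborel. f x)"
proof -
  have "(LINT x:{a..b}|lborel. k) \<le> (LINT x:{a..b}|lborel. f x)"
    using assms
    by (intro set_integral_mono set_integrable_bounded_Icc[where K="\<bar>k\<bar>"] set_integrable_bounded_Icc[where K=K]) auto
  moreover have "(LINT x:{a..b}|lborel. k) = k * (b - a)"
    using assms(4) by (simp add: set_lebesgue_integral_def)
  ultimately show ?thesis using assms(4) by (simp add: field_simps)
qed

lemma set_integral_interval_combine:
  fixes f :: "real \<Rightarrow> real"
  assumes "integrable lborel f" "a \<le> b" "b \<le> c"
  shows "(LINT x:{a..b}|lborel. f x) + (LINT x:{b..c}|lborel. f x) = (LINT x:{a..c}|lborel. f x)"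
proof -
  have s: "set_integrable lborel {p..q} f" for p q
    using assms(1) by (intro integrable_imp_set_integrable) (auto simp: set_integrable_def)
  show ?thesis
    unfolding set_borel_integral_eq_integral(2)[OF s]
    by (intro Henstock_Kurzweil_Integration.integral_combine assms set_borel_integral_eq_integral(1) s)
qed

lemma set_integral_shift:
  fixes f :: "real \<Rightarrow> real"
  shows "(LINT x:{a + r..b + r}|lborel. f x) = (LINT x:{a..b}|lborel. f (x + r))"
  unfolding set_lebesgue_integral_def
  by (subst lborel_integral_real_affine[of 1 _ r])
    (auto intro!: Bochner_Integration.integral_cong simp: indicator_def add_ac)

lemma sums_cells:
  fixes f :: "real \<Rightarrow> real"
  assumes f: "integrable lborel f" and neg: "\<And>x. x < 0 \<Longrightarrow> f x = 0" and h: "0 < h"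
  shows "(\<lambda>m. LINT x:{real m * h..real (Suc m) * h}|lborel. f x) sums (LINT x|lborel. f x)"
  unfolding sums_def
proof -
  have "(\<Sum>m<n. LINT x:{real m * h..real (Suc m) * h}|lborel. f x) = (LINT x:{0..real n * h}|lborel. f x)" for n
  proof (induction n)
    case 0
    have "(LINT x|lborel. indicator {0} x *\<^sub>R f x) = 0"
      by (intro integral_eq_zero_AE eventually_mono[OF AE_lborel_singleton[of 0]]) simp
    then show ?case by (simp add: set_lebesgue_integral_def)
  next
    case (Suc n)
    have "(LINT x:{0..real n * h}|lborel. f x) + (LINT x:{real n * h..real (Suc n) * h}|lborel. f x)
        = (LINT x:{0..real (Suc n) * h}|lborel. f x)"
      using h by (intro set_integral_interval_combine[OF f] mult_right_mono) auto
    then show ?case unfolding sum.lessThan_Suc Suc.IH .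
  qed
  moreover have "(\<lambda>n. LINT x|lborel. indicator {0..real n * h} x * f x) \<longlonglongrightarrow> (LINT x|lborel. f x)"
  proof (rule integral_dominated_convergence[where w="\<lambda>x. \<bar>f x\<bar>"])
    show "AE x in lborel. (\<lambda>n. indicator {0..real n * h} x * f x) \<longlonglongrightarrow> f x"
    proof (rule AE_I2)
      fix x
      have "\<forall>\<^sub>F n in sequentially. x / h \<le> real n"
        using eventually_ge_at_top[of "nat \<lceil>x / h\<rceil>"] by eventually_elim linarith
      then have "\<forall>\<^sub>F n in sequentially. f x = indicator {0..real n * h} x * f x"
      proof eventually_elim
        case (elim n)
        then have "x \<le> real n * h" using h by (simp add: pos_divide_le_eq)
        then show ?case using neg[of x] by (cases "x < 0") auto
      qed
      then show "(\<lambda>n. indicator {0..real n * h} x * f x) \<longlonglongrightarrow> f x"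
        by (rule Lim_transform_eventually[OF tendsto_const])
    qed
  qed (use f in \<open>auto simp: indicator_def\<close>)
  ultimately show "(\<lambda>n. \<Sum>m<n. LINT x:{real m * h..real (Suc m) * h}|lborel. f x) \<longlonglongrightarrow> (LINT x|lborel. f x)"
    by (simp add: set_lebesgue_integral_def)
qed

text \<open>Cell j is [(j - 1) h, j h), hence the shift by one after the floor.\<close>

definition stepf :: "real \<Rightarrow> (int \<Rightarrow> real) \<Rightarrow> real \<Rightarrow> real" where
  "stepf h v x = v (\<lfloor>x / h\<rfloor> + 1)"

lemma stepf_measurable [measurable]: "stepf h v \<in> borel_measurable borel"
  unfolding stepf_def by measurable

section \<open>Kernel masses of the cells\<close>

context kernel
begin

definition cellw :: "real \<Rightarrow> nat \<Rightarrow> real" where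
  "cellw h m = (LINT x:{real m * h..real (Suc m) * h}|lborel. F x)"

lemma cellw_nonneg: "0 \<le> cellw h m"
  unfolding cellw_def set_lebesgue_integral_def by (intro integral_nonneg_AE) (auto simp: F_nonneg)

lemma cellw_sums: "0 < h \<Longrightarrow> cellw h sums 1"
  using sums_cells[OF F_integrable F_neg] by (simp add: cellw_def[abs_def] F_integral)

lemma cellw_le_1: "0 < h \<Longrightarrow> cellw h m \<le> 1"
  using sum_le_suminf[of "cellw h" "{m}"] cellw_sums[of h] cellw_nonneg by (auto simp: sums_iff)

lemma F_set_integrable [simp]: "set_integrable lborel {a..b} F"
  using F_integrable by (intro integrable_imp_set_integrable) (auto simp: set_integrable_def)

lemma cellw_antimono:
  assumes h: "0 < h"
  shows "cellw h (Suc m) \<le> cellw h m"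
proof -
  have "cellw h (Suc m) = (LINT x:{real m * h..real (Suc m) * h}|lborel. F (x + h))"
    unfolding cellw_def set_integral_shift[symmetric] by (simp add: algebra_simps)
  also have "\<dots> \<le> cellw h m"
    unfolding cellw_def
  proof (rule set_integral_mono)
    have "integrable lborel (\<lambda>x. F (x + h))"
      using lborel_integrable_real_affine[OF F_integrable, of 1 h] by (simp add: add.commute)
    then show "set_integrable lborel {real m * h..real (Suc m) * h} (\<lambda>x. F (x + h))"
      by (intro integrable_imp_set_integrable) (auto simp: set_integrable_def)
    fix x assume "x \<in> {real m * h..real (Suc m) * h}"
    moreover have "0 \<le> real m * h" using h by simp
    ultimately have "0 \<le> x" by (auto dest: order_trans)
    then show "F (x + h) \<le> F x" using h by (intro F_noninc) auto
  qed simp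
  finally show ?thesis .
qed

text \<open>Since the step function is constant on cells, the discrete sum is an exact average with
  no quadrature error, taken at the left interface of cell i. All estimates for \<open>av\<close>
  thus apply to the scheme.\<close>

lemma cellw_step_sums:
  assumes h: "0 < h" and B: "\<And>j. \<bar>v j\<bar> \<le> B"
  shows "(\<lambda>m. cellw h m * v (i + int m)) sums av (stepf h v) (real_of_int (i - 1) * h)"
proof -
  let ?q = "real_of_int (i - 1) * h"
  let ?f = "\<lambda>x. F x * stepf h v (?q + x)"
  have "(\<lambda>m. LINT x:{real m * h..real (Suc m) * h}|lborel. ?f x) sums (LINT x|lborel. ?f x)"
    by (rule sums_cells[OF av_integrable[where B=B]]) (use B h F_neg in \<open>auto simp: stepf_def\<close>)
  moreover have "(LINT x:{real m * h..real (Suc m) * h}|lborel. ?f x) = cellw h m * v (i + int m)" for m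
  proof -
    have "(LINT x:{real m * h..real (Suc m) * h}|lborel. ?f x)
        = (LINT x:{real m * h..real (Suc m) * h}|lborel. F x * v (i + int m))"
    proof (rule set_lebesgue_integral_cong_AE)
      \<comment> \<open>The right end point belongs to the next cell, so the integrands agree only
        almost everywhere.\<close>
      have "stepf h v (?q + x) = v (i + int m)" if "x \<in> {real m * h..real (Suc m) * h}" "x \<noteq> real (Suc m) * h" for x
      proof -
        have "x < real (Suc m) * h" using that by auto
        then have "\<lfloor>(?q + x) / h\<rfloor> = i - 1 + int m"
          using that h by (intro floor_unique) (auto simp: field_simps)
        then show ?thesis by (simp add: stepf_def)
      qed
      then show "AE x\<in>{real m * h..real (Suc m) * h} in lborel. ?f x = F x * v (i + int m)"
        using AE_lborel_singleton[of "real (Suc m) * h"] by (auto elim!: eventually_mono)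
    qed auto
    then show ?thesis by (simp add: cellw_def)
  qed
  ultimately show ?thesis by (simp add: av_def)
qed

text \<open>Since the cell masses decrease, moving the interface one cell to the right loses at most the
  contribution of the first cell.\<close>

lemma av_step_difference_ge:
  assumes h: "0 < h" and B: "\<And>j. \<bar>v j\<bar> \<le> B" and k: "\<And>j. k \<le> v j"
  shows "av (stepf h v) (real_of_int i * h) - av (stepf h v) (real_of_int (i - 1) * h) \<ge> - (v i - k)"
proof -
  let ?p = "cellw h"
  \<comment> \<open>The masses sum to 1, so subtracting k shifts both averages alike; it makes the
    terms nonnegative, and then smaller masses mean smaller terms.\<close>
  have s: "(\<lambda>m. ?p m * (v (j + int m) - k)) sums (av (stepf h v) (real_of_int (j - 1) * h) - k)" for j
    using sums_diff[OF cellw_step_sums[where v=v, OF h B] sums_mult2[OF cellw_sums[OF h], of k]]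
    by (simp add: algebra_simps)
  have s1: "(\<lambda>m. ?p (Suc m) * (v (i + 1 + int m) - k)) sums (av (stepf h v) (real_of_int (i - 1) * h) - k - ?p 0 * (v i - k))"
    using s[of i] sums_Suc_iff[of "\<lambda>m. ?p m * (v (i + int m) - k)"] by (simp add: add_ac)
  have le: "?p (Suc m) * (v (i + 1 + int m) - k) \<le> ?p m * (v (i + 1 + int m) - k)" for m
    using cellw_antimono[OF h] k by (intro mult_right_mono) auto
  have s2: "(\<lambda>m. ?p m * (v (i + 1 + int m) - k)) sums (av (stepf h v) (real_of_int i * h) - k)"
    using s[of "i + 1"] by simp
  have "av (stepf h v) (real_of_int (i - 1) * h) - k - ?p 0 * (v i - k) \<le> av (stepf h v) (real_of_int i * h) - k"
    by (rule sums_le[OF le s1 s2])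
  moreover have "?p 0 * (v i - k) \<le> 1 * (v i - k)"
    using cellw_le_1[OF h] k[of i] by (intro mult_right_mono) auto
  ultimately show ?thesis by simp
qed

text \<open>On each cell the deviation of y from its mean integrates to zero, so F can be replaced
  there by F minus its value at the right end. These oscillations of a non-increasing F telescope to
  at most F 0, which gives first order in h without any continuity of y.\<close>

lemma av_cell_average_error:
  assumes h: "0 < h" and [measurable]: "y \<in> borel_measurable borel" and B: "\<And>x. \<bar>y x\<bar> \<le> B"
    and ym: "\<And>m. ym m = (1 / h) * (LINT x:{real m * h..real (Suc m) * h}|lborel. y (q + x))"
  shows "summable (\<lambda>m. cellw h m * ym m)" (is ?sm)
    and "\<bar>(\<Sum>m. cellw h m * ym m) - av y q\<bar> \<le> 2 * B * F 0 * h"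
proof -
  define I where "I m = {real m * h..real (Suc m) * h}" for m
  have len: "real (Suc m) * h - real m * h = h" for m by (simp add: algebra_simps)
  have I_meas: "measure lborel (I m) = h" for m
    unfolding I_def using h len[of m] by (subst measure_lborel_Icc) (auto intro: mult_right_mono)
  have I_int: "set_integrable lborel (I m) f"
    if "f \<in> borel_measurable borel" and "\<And>x. \<bar>f x\<bar> \<le> K" for f :: "real \<Rightarrow> real" and m K
    unfolding I_def by (rule set_integrable_bounded_Icc[OF that])
  have I_bd: "\<bar>LINT x:I m|lborel. f x\<bar> \<le> K * h" if [measurable]: "f \<in> borel_measurable borel" and b: "\<And>x. x \<in> I m \<Longrightarrow> \<bar>f x\<bar> \<le> K" and K: "0 \<le> K" for f :: "real \<Rightarrow> real" and m K
  proof -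
    have "\<bar>LINT x:I m|lborel. f x\<bar> \<le> (LINT x|lborel. \<bar>indicator (I m) x *\<^sub>R f x\<bar>)"
      unfolding set_lebesgue_integral_def by (rule integral_abs_bound)
    also have "\<dots> \<le> (LINT x|lborel. K * indicator (I m) x)"
    proof (rule integral_mono')
      show "integrable lborel (\<lambda>x. K * indicator (I m) x)"
        unfolding I_def by (intro integrable_mult_right integrable_real_indicator) (use h in \<open>auto simp: len emeasure_lborel_Icc_eq\<close>)
    qed (use b K in \<open>auto simp: indicator_def\<close>)
    also have "\<dots> = K * h" by (simp add: I_meas)
    finally show ?thesis .
  qed
  have B0: "0 \<le> B" using B[of 0] by linarith
  have ym_bd: "\<bar>ym m\<bar> \<le> B" for m
    using I_bd[of "\<lambda>x. y (q + x)" m B] B B0 h unfolding ym I_def[symmetric]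
    by (simp add: abs_mult field_simps)
  have "summable (\<lambda>m. B * cellw h m)"
    using cellw_sums[OF h] by (intro summable_mult) (auto simp: sums_iff)
  then show sm: ?sm
  proof (rule summable_comparison_test'[where N=0])
    show "norm (cellw h m * ym m) \<le> B * cellw h m" for m
      using mult_left_mono[OF ym_bd[of m] cellw_nonneg[of h m]] cellw_nonneg[of h m]
      by (simp add: abs_mult mult.commute)
  qed
  let ?g = "\<lambda>m. LINT x:I m|lborel. F x * y (q + x)"
  have g: "?g sums av y q"
    unfolding I_def av_def by (rule sums_cells[OF av_integrable[OF _ B]]) (use h F_neg in auto)
  have term_bd: "\<bar>cellw h m * ym m - ?g m\<bar> \<le> 2 * B * h * (F (real m * h) - F (real (Suc m) * h))" for m
  proof -
    let ?A = "F (real (Suc m) * h)"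
    have i1: "set_integrable lborel (I m) F" "set_integrable lborel (I m) (\<lambda>x. y (q + x))"
      "set_integrable lborel (I m) (\<lambda>x. F x * y (q + x))"
      subgoal by (rule I_int[where K="F 0"]) (use F_le F_nonneg in auto)
      subgoal by (rule I_int[where K=B]) (use B in auto)
      subgoal by (rule I_int[where K="F 0 * B"]) (use F_le F_nonneg B in \<open>auto simp: abs_mult intro!: mult_mono\<close>)
      done
    have "(LINT x:I m|lborel. (F x - ?A) * (ym m - y (q + x)))
        = (LINT x:I m|lborel. (ym m * F x - F x * y (q + x)) - (?A * ym m - ?A * y (q + x)))"
      by (simp add: algebra_simps)
    also have "\<dots> = (ym m * (LINT x:I m|lborel. F x) - ?g m) - (?A * ym m * h - ?A * (LINT x:I m|lborel. y (q + x)))"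
    proof -
      have c: "set_integrable lborel (I m) (\<lambda>x. ?A * ym m)" by (rule I_int[where K="\<bar>?A * ym m\<bar>"]) auto
      have "(LINT x:I m|lborel. ?A * ym m) = ?A * ym m * h"
        by (simp add: set_lebesgue_integral_def I_meas)
      then show ?thesis
        using i1 c by (simp add: set_integral_diff)
    qed
    also have "\<dots> = cellw h m * ym m - ?g m"
      using h unfolding ym by (simp add: cellw_def I_def mult.commute)
    finally have "cellw h m * ym m - ?g m = (LINT x:I m|lborel. (F x - ?A) * (ym m - y (q + x)))" by simp
    also have "\<bar>\<dots>\<bar> \<le> ((F (real m * h) - ?A) * (2 * B)) * h"
    proof (rule I_bd)
      fix x assume x: "x \<in> I m"
      have "0 \<le> real m * h" using h by simp
      then have "F x \<le> F (real m * h)" "?A \<le> F x"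
        using x unfolding I_def by (auto intro!: F_noninc)
      moreover have "\<bar>ym m - y (q + x)\<bar> \<le> 2 * B" using ym_bd[of m] B[of "q + x"] by linarith
      ultimately show "\<bar>(F x - ?A) * (ym m - y (q + x))\<bar> \<le> (F (real m * h) - ?A) * (2 * B)"
        unfolding abs_mult by (intro mult_mono) auto
    next
      show "0 \<le> (F (real m * h) - ?A) * (2 * B)"
        using B0 h by (intro mult_nonneg_nonneg) (auto intro!: F_noninc mult_right_mono)
    qed measurable
    finally show ?thesis by (simp add: mult_ac)
  qed
  have "\<bar>\<Sum>m<n. cellw h m * ym m - ?g m\<bar> \<le> 2 * B * F 0 * h" for n
  proof -
    have "\<bar>\<Sum>m<n. cellw h m * ym m - ?g m\<bar> \<le> (\<Sum>m<n. 2 * B * h * (F (real m * h) - F (real (Suc m) * h)))"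
      by (rule order_trans[OF sum_abs sum_mono[OF term_bd]])
    also have "\<dots> = 2 * B * h * (F 0 - F (real n * h))"
      unfolding sum_distrib_left[symmetric] using sum_lessThan_telescope'[of "\<lambda>m. F (real m * h)" n] by simp
    also have "\<dots> \<le> 2 * B * h * F 0" using F_nonneg B0 h by (intro mult_left_mono) auto
    finally show ?thesis by (simp add: mult_ac)
  qed
  moreover have "(\<lambda>m. cellw h m * ym m - ?g m) sums ((\<Sum>m. cellw h m * ym m) - av y q)"
    by (intro sums_diff g summable_sums sm)
  ultimately show "\<bar>(\<Sum>m. cellw h m * ym m) - av y q\<bar> \<le> 2 * B * F 0 * h"
    unfolding sums_def by (intro LIMSEQ_le_const2[OF tendsto_rabs]) auto
qed

end

section \<open>Convergence of the scheme\<close>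

lemma abs_convex_combination4:
  fixes a b :: real
  assumes "0 \<le> a" "a \<le> 1" "0 \<le> b" "b \<le> 1"
    and "\<bar>x1 - y\<bar> \<le> D" "\<bar>x2 - y\<bar> \<le> D" "\<bar>x3 - y\<bar> \<le> D" "\<bar>x4 - y\<bar> \<le> D"
  shows "\<bar>(1 - a) * (1 - b) * x1 + a * (1 - b) * x2 + (1 - a) * b * x3 + a * b * x4 - y\<bar> \<le> D"
proof -
  have "(1 - a) * (1 - b) * x1 + a * (1 - b) * x2 + (1 - a) * b * x3 + a * b * x4 - y
      = (1 - a) * (1 - b) * (x1 - y) + a * (1 - b) * (x2 - y) + (1 - a) * b * (x3 - y) + a * b * (x4 - y)"
    by (simp add: algebra_simps)
  also have "\<bar>\<dots>\<bar> \<le> (1 - a) * (1 - b) * D + a * (1 - b) * D + (1 - a) * b * D + a * b * D"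
    by (intro order_trans[OF abs_triangle_ineq] add_mono)
      (use assms in \<open>auto simp: abs_mult intro!: mult_left_mono\<close>)
  also have "\<dots> = D" by (simp add: algebra_simps)
  finally show ?thesis .
qed

lemma bilinE:
  assumes h: "0 < h" and \<tau>: "0 < \<tau>" and t: "0 \<le> t"
  obtains i n a b where "0 \<le> a" "a \<le> 1" "0 \<le> b" "b \<le> 1"
    and "z = (real_of_int i - 1 / 2) * h + a * h" "t = real n * \<tau> + b * \<tau>"
    and "\<And>g. bilin h \<tau> g z t = (1 - a) * (1 - b) * g n i + a * (1 - b) * g n (i + 1)
        + (1 - a) * b * g (Suc n) i + a * b * g (Suc n) (i + 1)"
proof -
  define i where "i = \<lfloor>z / h + 1 / 2\<rfloor>"
  define a where "a = (z - (real_of_int i - 1 / 2) * h) / h"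
  define n where "n = nat \<lfloor>t / \<tau>\<rfloor>"
  define b where "b = (t - real n * \<tau>) / \<tau>"
  have a_eq: "a = z / h + 1 / 2 - real_of_int i" using h by (simp add: a_def field_simps)
  have a: "0 \<le> a" "a \<le> 1" unfolding a_eq i_def by linarith+
  have "0 \<le> \<lfloor>t / \<tau>\<rfloor>" using t \<tau> by simp
  then have nr: "real n = real_of_int \<lfloor>t / \<tau>\<rfloor>" by (simp add: n_def)
  have b_eq: "b = t / \<tau> - real n" using \<tau> by (simp add: b_def field_simps)
  have b: "0 \<le> b" "b \<le> 1" unfolding b_eq nr by linarith+
  have "z = (real_of_int i - 1 / 2) * h + a * h" "t = real n * \<tau> + b * \<tau>"
    using h \<tau> by (simp_all add: a_def b_def)
  then show thesis
    by (rule that[OF a b]) (simp add: bilin_def Let_def a_def b_def i_def n_def)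
qed

text \<open>The interpolant is a convex combination of four nodal values within h and \<tau> of (z,
  t). The upper nodes may lie up to \<tau> after t, which explains the condition t + \<tau> <=
  T'.\<close>

lemma bilin_error:
  assumes h: "0 < h" and \<tau>: "0 < \<tau>" and u: "lip_on L T' u" and t: "0 \<le> t" "t + \<tau> \<le> T'"
    and g: "\<And>n i. real n * \<tau> \<le> T' \<Longrightarrow> \<bar>g n i - u ((real_of_int i - 1/2) * h) (real n * \<tau>)\<bar> \<le> E"
  shows "\<bar>bilin h \<tau> g z t - u z t\<bar> \<le> E + L * (h + \<tau>)"
proof -
  obtain i n a b where a: "0 \<le> a" "a \<le> 1" and b: "0 \<le> b" "b \<le> 1"
    and z_eq: "z = (real_of_int i - 1 / 2) * h + a * h" and t_eq: "t = real n * \<tau> + b * \<tau>"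
    and eq: "bilin h \<tau> g z t = (1 - a) * (1 - b) * g n i + a * (1 - b) * g n (i + 1)
        + (1 - a) * b * g (Suc n) i + a * b * g (Suc n) (i + 1)"
    using bilinE[OF h \<tau> t(1)] by metis
  have "0 \<le> T'" using t \<tau> by simp
  then have L: "0 \<le> L" using lip_on_nonneg[OF u] by simp
  have ah: "0 \<le> a * h" "a * h \<le> h" using a h by (auto intro: mult_left_le_one_le)
  have bt: "0 \<le> b * \<tau>" "b * \<tau> \<le> \<tau>" using b \<tau> by (auto intro: mult_left_le_one_le)
  have corner: "\<bar>g n' i' - u z t\<bar> \<le> E + L * (h + \<tau>)"
    if "n' = n \<or> n' = Suc n" "i' = i \<or> i' = i + 1" for n' i'
  proof -
    have n': "real n' * \<tau> \<le> T'" using that(1) t_eq bt t by (auto simp: algebra_simps)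
    have d: "\<bar>real n' * \<tau> - t\<bar> \<le> \<tau>" using that(1) t_eq bt by (auto simp: algebra_simps)
    have dz: "\<bar>(real_of_int i' - 1/2) * h - z\<bar> \<le> h" using that(2) z_eq ah by (auto simp: algebra_simps)
    have "\<bar>u ((real_of_int i' - 1/2) * h) (real n' * \<tau>) - u z t\<bar>
        \<le> L * (\<bar>(real_of_int i' - 1/2) * h - z\<bar> + \<bar>real n' * \<tau> - t\<bar>)"
      using n' t \<tau> by (intro lip_onD[OF u]) auto
    also have "\<dots> \<le> L * (h + \<tau>)" using d dz L by (intro mult_left_mono) auto
    finally show ?thesis using g[OF n', of i'] by linarith
  qed
  show ?thesis unfolding eq by (intro abs_convex_combination4[OF a b] corner) auto
qed

lemma bilin_ge:
  assumes "0 < h" "0 < \<tau>" "0 \<le> t" and g: "\<And>n i. k \<le> g n i"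
  shows "k \<le> bilin h \<tau> g z t"
proof -
  obtain i n a b where a: "0 \<le> a" "a \<le> 1" and b: "0 \<le> b" "b \<le> 1"
    and eq: "bilin h \<tau> g z t = (1 - a) * (1 - b) * g n i + a * (1 - b) * g n (i + 1)
        + (1 - a) * b * g (Suc n) i + a * b * g (Suc n) (i + 1)"
    using bilinE[OF assms(1-3)] by metis
  have "k = (1 - a) * (1 - b) * k + a * (1 - b) * k + (1 - a) * b * k + a * b * k"
    by (simp add: algebra_simps)
  also have "\<dots> \<le> bilin h \<tau> g z t"
    unfolding eq using a b by (intro add_mono mult_left_mono g mult_nonneg_nonneg) auto
  finally show ?thesis .
qed

section \<open>Error propagation for the explicit Euler step\<close>

context nonlocal_flux
begin

text \<open>Consistency comes from the mean value theorem for \<open>Aw u\<close>, whose space derivative is \<open>N u\<close>,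
  and stability from the Lipschitz estimate for \<open>av\<close>.\<close>

lemma scheme_step_error:
  assumes u: "lip_on L T u" and m: "mild T u" and h: "0 < h" and t: "0 \<le> t" and \<tau>: "0 < \<tau>" and s: "t + \<tau> \<le> T"
    and e: "\<And>i. \<bar>w i - u ((real_of_int i - 1/2) * h) t\<bar> \<le> E"
    and z: "z = (real_of_int i - 1/2) * h"
    and w': "w' = w i + (\<tau> / h) * (av (stepf h (\<lambda>j. W (w j))) (real_of_int i * h)
        - av (stepf h (\<lambda>j. W (w j))) (real_of_int (i - 1) * h))"
  shows "\<bar>w' - u z (t + \<tau>)\<bar> \<le> E + C * \<tau> * (E + L * (2 * h + \<tau>))"
proof -
  have tT: "t \<in> {0..T}" and sT: "t + \<tau> \<in> {0..T}" and T: "0 \<le> T" using t \<tau> s by auto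
  have L: "0 \<le> L" by (rule lip_on_nonneg[OF u T])
  let ?S = "stepf h (\<lambda>j. W (w j))" and ?v = "\<lambda>x. W (u x t)"
  let ?r = "real_of_int i * h" and ?l = "real_of_int (i - 1) * h"
  note [measurable] = blip_measurable[OF blip_W[of "\<lambda>x. u x t", OF lip_on_space[OF u tT]]]
  have Sv: "\<bar>?S x - ?v x\<bar> \<le> Lw * (E + L * h)" for x
  proof -
    define j where "j = \<lfloor>x / h\<rfloor> + 1"
    have "real_of_int (j - 1) \<le> x / h" "x / h \<le> real_of_int j" unfolding j_def by linarith+
    then have "\<bar>(real_of_int j - 1/2) * h - x\<bar> \<le> h" using h by (auto simp: field_simps abs_le_iff)
    then have "L * (\<bar>(real_of_int j - 1/2) * h - x\<bar> + \<bar>t - t\<bar>) \<le> L * h" using L by (auto intro: mult_left_mono)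
    then have "\<bar>w j - u x t\<bar> \<le> E + L * h"
      using lip_onD[OF u tT tT, of "(real_of_int j - 1/2) * h" x] e[of j] by linarith
    then show ?thesis
      using W_lip[of "w j" "u x t"] mult_left_mono[OF _ Lw_nonneg, of "\<bar>w j - u x t\<bar>" "E + L * h"]
      by (simp add: stepf_def j_def)
  qed
  have av_eq: "av ?S x - av ?v x = av (\<lambda>x. ?S x - ?v x) x" for x
    by (rule av_diff[symmetric, where B=Bw and C=Bw]) (auto simp: stepf_def W_bound)
  \<comment> \<open>The interfaces are h apart, so the Lipschitz bound supplies a factor h that
    compensates the 1 / h in the step; the error grows only by a factor 1 + O(\<tau>).\<close>
  have "\<bar>av (\<lambda>x. ?S x - ?v x) ?r - av (\<lambda>x. ?S x - ?v x) ?l\<bar> \<le> 2 * F 0 * (Lw * (E + L * h)) * \<bar>?r - ?l\<bar>"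
    by (rule av_lipschitz) (use Sv in auto)
  also have "\<bar>?r - ?l\<bar> = h" using h by (simp add: algebra_simps)
  finally have stab: "\<bar>(av ?S ?r - av ?S ?l) - (av ?v ?r - av ?v ?l)\<bar> \<le> C * (E + L * h) * h"
    unfolding av_eq[symmetric] C_def by (simp add: algebra_simps)
  \<comment> \<open>For the exact solution the flux difference equals h times \<open>N u t\<close>
    at some point of the cell, hence within h of the node.\<close>
  have "?l < ?r" using h by simp
  then obtain \<xi> where \<xi>: "?l < \<xi>" "\<xi> < ?r" and mvt: "Aw u ?r t - Aw u ?l t = (?r - ?l) * N u t \<xi>"
    using MVT2[of ?l ?r "\<lambda>z. Aw u z t" "N u t"] Aw_has_derivative[OF u tT] by blast
  have Av: "av ?v ?r - av ?v ?l = h * N u t \<xi>"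
    using mvt by (simp add: Aw_def algebra_simps)
  have z\<xi>: "\<bar>z - \<xi>\<bar> \<le> h" using \<xi> h unfolding z by (auto simp: abs_le_iff algebra_simps)
  have int: "(\<lambda>r. N u r z) integrable_on {a..b}" if "{a..b} \<subseteq> {0..T}" for a b
    using that by (intro integrable_continuous_real continuous_on_subset[OF N_continuous_lip_on[OF u]])
  have "u z (t + \<tau>) = u z 0 + integral {0..t + \<tau>} (\<lambda>r. N u r z)" "u z t = u z 0 + integral {0..t} (\<lambda>r. N u r z)"
    using m tT sT unfolding mild_def by blast+
  moreover have "integral {0..t} (\<lambda>r. N u r z) + integral {t..t + \<tau>} (\<lambda>r. N u r z) = integral {0..t + \<tau>} (\<lambda>r. N u r z)"
    using tT sT \<tau> by (intro Henstock_Kurzweil_Integration.integral_combine int) auto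
  ultimately have uinc: "u z (t + \<tau>) - u z t = integral {t..t + \<tau>} (\<lambda>r. N u r z)" by linarith
  have "\<bar>integral {t..t + \<tau>} (\<lambda>r. N u r z) - \<tau> * N u t \<xi>\<bar> \<le> C * L * (h + \<tau>) * \<tau>"
  proof -
    have "integral {t..t + \<tau>} (\<lambda>r. N u r z) - \<tau> * N u t \<xi> = integral {t..t + \<tau>} (\<lambda>r. N u r z - N u t \<xi>)"
      using \<tau> tT sT int[of t "t + \<tau>"] by (subst integral_diff) auto
    also have "norm \<dots> \<le> C * L * (h + \<tau>) * (t + \<tau> - t)"
    proof (rule integral_bound)
      show "continuous_on {t..t + \<tau>} (\<lambda>r. N u r z - N u t \<xi>)"
        using tT sT by (intro continuous_intros continuous_on_subset[OF N_continuous_lip_on[OF u]]) auto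
      fix r assume r: "r \<in> {t..t + \<tau>}"
      then have rT: "r \<in> {0..T}" using tT sT by auto
      have "\<bar>N u r z - N u t z\<bar> \<le> C * (L * \<bar>r - t\<bar>)"
        by (rule N_diff[of u r L u t L]) (use lip_on_space[OF u rT] lip_on_space[OF u tT] lip_on_time[OF u rT tT] in auto)
      also have "\<dots> \<le> C * (L * \<tau>)" using r C_nonneg L by (intro mult_left_mono) auto
      finally have 1: "\<bar>N u r z - N u t z\<bar> \<le> C * (L * \<tau>)" .
      have "\<bar>N u t z - N u t \<xi>\<bar> \<le> C * L * \<bar>z - \<xi>\<bar>" by (rule N_lip[of u t, OF lip_on_space[OF u tT]])
      also have "\<dots> \<le> C * L * h" using z\<xi> C_nonneg L by (intro mult_left_mono) auto
      finally show "norm (N u r z - N u t \<xi>) \<le> C * L * (h + \<tau>)" using 1 by (simp add: algebra_simps)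
    qed (use \<tau> in auto)
    finally show ?thesis by simp
  qed
  moreover have "\<bar>(\<tau> / h) * (av ?S ?r - av ?S ?l) - \<tau> * N u t \<xi>\<bar> \<le> \<tau> * (C * (E + L * h))"
  proof -
    have "(\<tau> / h) * (av ?S ?r - av ?S ?l) - \<tau> * N u t \<xi> = (\<tau> / h) * ((av ?S ?r - av ?S ?l) - (av ?v ?r - av ?v ?l))"
      using h unfolding Av by (simp add: field_simps)
    also have "\<bar>\<dots>\<bar> \<le> (\<tau> / h) * (C * (E + L * h) * h)"
    proof -
      have "\<bar>\<tau> / h\<bar> = \<tau> / h" using \<tau> h by simp
      then show ?thesis unfolding abs_mult using \<tau> h by (simp only:) (intro mult_left_mono stab, simp)
    qed
    also have "\<dots> = \<tau> * (C * (E + L * h))" using h by simp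
    finally show ?thesis .
  qed
  \<comment> \<open>One L h comes from replacing u by a step function, another from the intermediate
    point, and L \<tau> from freezing time: together L (2 h + \<tau>).\<close>
  ultimately have "\<bar>w' - u z (t + \<tau>)\<bar> \<le> E + \<tau> * (C * (E + L * h)) + C * L * (h + \<tau>) * \<tau>"
    using e[of i] uinc unfolding w' z[symmetric] by linarith
  then show ?thesis by (simp add: algebra_simps)
qed

lemma scheme_error:
  assumes u: "lip_on L T u" and m: "mild T u" and h: "0 < h" and \<tau>: "0 < \<tau>" and T: "0 \<le> T"
    and e0: "\<And>i. \<bar>w 0 i - u ((real_of_int i - 1/2) * h) 0\<bar> \<le> E"
    and w: "\<And>n i. w (Suc n) i = w n i + (\<tau> / h) * (av (stepf h (\<lambda>j. W (w n j))) (real_of_int i * h)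
        - av (stepf h (\<lambda>j. W (w n j))) (real_of_int (i - 1) * h))"
    and n: "real n * \<tau> \<le> T"
  shows "\<bar>w n i - u ((real_of_int i - 1/2) * h) (real n * \<tau>)\<bar> \<le> exp (C * T) * (E + L * (2 * h + \<tau>))"
proof -
  \<comment> \<open>Consistency error per step. The recursion D' = D + C \<tau> (D + \<kappa>) is
    exactly geometric for D + \<kappa>, with ratio 1 + C \<tau>.\<close>
  define \<kappa> where "\<kappa> = L * (2 * h + \<tau>)"
  have L: "0 \<le> L" by (rule lip_on_nonneg[OF u T])
  have \<kappa>: "0 \<le> \<kappa>" using L h \<tau> by (simp add: \<kappa>_def)
  have E: "0 \<le> E" using e0[of 0] by linarith
  have "\<bar>w n i - u ((real_of_int i - 1/2) * h) (real n * \<tau>)\<bar> \<le> (1 + C * \<tau>) ^ n * (E + \<kappa>) - \<kappa>"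
    using n
  proof (induction n arbitrary: i)
    case 0
    then show ?case using e0[of i] by simp
  next
    case (Suc n)
    let ?D = "(1 + C * \<tau>) ^ n * (E + \<kappa>) - \<kappa>"
    have le: "real n * \<tau> + \<tau> \<le> T" using Suc.prems by (simp add: algebra_simps)
    then have n: "real n * \<tau> \<le> T" using \<tau> by simp
    have "\<bar>w (Suc n) i - u ((real_of_int i - 1/2) * h) (real n * \<tau> + \<tau>)\<bar> \<le> ?D + C * \<tau> * (?D + L * (2 * h + \<tau>))"
      by (rule scheme_step_error[OF u m h _ \<tau> le Suc.IH[OF n] refl w]) (use \<tau> in simp)
    also have "\<dots> = (1 + C * \<tau>) ^ Suc n * (E + \<kappa>) - \<kappa>"
      unfolding \<kappa>_def[symmetric] by (simp add: algebra_simps)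
    also have "real n * \<tau> + \<tau> = real (Suc n) * \<tau>" by (simp add: algebra_simps)
    finally show ?case .
  qed
  also have "\<dots> \<le> exp (C * T) * (E + \<kappa>)"
  proof -
    have "(1 + C * \<tau>) ^ n \<le> exp (C * \<tau>) ^ n"
      using C_nonneg \<tau> exp_ge_add_one_self[of "C * \<tau>"] by (intro power_mono) auto
    also have "\<dots> = exp (C * (real n * \<tau>))" by (simp add: exp_of_nat_mult[symmetric] mult_ac)
    also have "\<dots> \<le> exp (C * T)" using n C_nonneg by (simp add: mult_left_mono)
    finally have "(1 + C * \<tau>) ^ n * (E + \<kappa>) \<le> exp (C * T) * (E + \<kappa>)"
      using E \<kappa> by (intro mult_right_mono) auto
    then show ?thesis using \<kappa> by simp
  qed
  finally show ?thesis by (simp add: \<kappa>_def)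
qed

end

section \<open>The convergence theorem\<close>

lemma BV_real_bounded:
  assumes "BV_real f"
  obtains B where "\<And>x. \<bar>f x\<bar> \<le> B"
proof -
  obtain K where K: "\<And>xs. sorted xs \<Longrightarrow> (\<Sum>i<length xs - 1. \<bar>f (xs ! Suc i) - f (xs ! i)\<bar>) \<le> K"
    using assms by (auto simp: BV_real_def)
  have "\<bar>f x\<bar> \<le> K + \<bar>f 0\<bar>" for x
  proof (cases "0 \<le> x")
    case True
    then have "\<bar>f x - f 0\<bar> \<le> K" using K[of "[0, x]"] by simp
    then show ?thesis by linarith
  next
    case False
    then have "\<bar>f 0 - f x\<bar> \<le> K" using K[of "[x, 0]"] by simp
    then show ?thesis by linarith
  qed
  then show thesis using that by blast
qed

definition kern :: "(real \<Rightarrow> real) \<Rightarrow> real \<Rightarrow> real \<Rightarrow> real" where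
  "kern Phi \<alpha> x = (if x < 0 then 0 else Phi_a Phi \<alpha> x)"

lemma kernel_kern:
  assumes "\<forall>z\<ge>0. Phi z \<ge> 0" "\<forall>x y. 0 \<le> x \<longrightarrow> x \<le> y \<longrightarrow> Phi y \<le> Phi x"
    and int: "set_integrable lborel {0..} Phi" and int1: "(LINT z:{0..}|lborel. Phi z) = 1" and \<alpha>: "\<alpha> > 0"
  shows "kernel (kern Phi \<alpha>)"
proof
  let ?g = "\<lambda>x. indicator {0..} x *\<^sub>R Phi x"
  have eq: "kern Phi \<alpha> = (\<lambda>x. (1 / \<alpha>) * ?g (0 + (1 / \<alpha>) * x))"
    using \<alpha> by (auto simp: kern_def Phi_a_def fun_eq_iff indicator_def divide_less_0_iff zero_le_divide_iff)
  have g: "integrable lborel ?g" using int by (simp add: set_integrable_def)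
  show "integrable lborel (kern Phi \<alpha>)"
    unfolding eq using \<alpha> by (intro integrable_mult_right lborel_integrable_real_affine[OF g]) simp
  show "integral\<^sup>L lborel (kern Phi \<alpha>) = 1"
    using lborel_integral_real_affine[of "1 / \<alpha>" ?g 0] int1 \<alpha> unfolding eq
    by (simp add: set_lebesgue_integral_def)
  show "kern Phi \<alpha> y \<le> kern Phi \<alpha> x" if "0 \<le> x" "x \<le> y" for x y
    using that assms(2) \<alpha> by (auto simp: kern_def Phi_a_def divide_right_mono)
qed (use assms in \<open>auto simp: kern_def Phi_a_def\<close>)

lemma (in kernel) avg_eq_av:
  assumes "F = kern Phi \<alpha>"
  shows "avg Phi \<alpha> v z = av v z"
  unfolding avg_def av_def set_lebesgue_integral_def
  by (intro Bochner_Integration.integral_cong) (auto simp: assms kern_def indicator_def)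

text \<open>Cell and interface shift together, so the weights depend on j - i only.\<close>

lemma (in kernel) Phi_ij_eq_cellw:
  assumes "F = kern Phi \<alpha>" and h: "0 < h"
  shows "Phi_ij Phi \<alpha> h i (i + int m) = cellw h m"
proof -
  let ?r = "real_of_int (i - 1) * h"
  have "Phi_ij Phi \<alpha> h i (i + int m) = (LINT x:{real m * h + ?r..real (Suc m) * h + ?r}|lborel. Phi_a Phi \<alpha> (x - ?r))"
    unfolding Phi_ij_def by (simp add: algebra_simps)
  also have "\<dots> = (LINT x:{real m * h..real (Suc m) * h}|lborel. Phi_a Phi \<alpha> x)"
    unfolding set_integral_shift by simp
  also have "\<dots> = cellw h m"
    unfolding cellw_def
  proof (rule set_lebesgue_integral_cong)
    have "0 \<le> real m * h" using h by simp
    then show "\<forall>x. x \<in> {real m * h..real (Suc m) * h} \<longrightarrow> Phi_a Phi \<alpha> x = F x"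
      by (auto simp: assms kern_def)
  qed simp
  finally show ?thesis .
qed

lemma Wf_increment:
  assumes V_C1: "\<exists>V'. continuous_on {0..} V' \<and> (\<forall>x\<ge>0. (V has_real_derivative V' x) (at x within {0..}))"
    and V_noninc: "\<forall>x y. 0 \<le> x \<longrightarrow> x \<le> y \<longrightarrow> V y \<le> V x"
    and xy: "1 \<le> x" "x \<le> y"
  shows "0 \<le> Wf V y - Wf V x" "Wf V y - Wf V x \<le> (SUP w\<in>{1..}. deriv (Wf V) w) * (y - x)"
proof -
  obtain V' where c: "continuous_on {0..} V'"
    and d: "\<And>x. 0 \<le> x \<Longrightarrow> (V has_real_derivative V' x) (at x within {0..})"
    using V_C1 by blast
  have dW: "(Wf V has_real_derivative - V' (1 / w) / w\<^sup>2) (at w)" if "1 \<le> w" for w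
  proof -
    have "(V has_real_derivative V' (1 / w)) (at (1 / w))"
      using d[of "1 / w"] that at_within_interior[of "1 / w" "{0..}"] by simp
    moreover have "((\<lambda>w. 1 / w) has_real_derivative - (1 / w\<^sup>2)) (at w)"
      using that by (auto intro!: derivative_eq_intros simp: power2_eq_square)
    ultimately have "((\<lambda>w. V (1 / w)) has_real_derivative V' (1 / w) * - (1 / w\<^sup>2)) (at w)"
      by (rule DERIV_chain2)
    then show ?thesis by (simp add: Wf_def[abs_def])
  qed
  \<comment> \<open>The real supremum in the CFL condition bounds its members only if the set is
    bounded above. It is, because 1 / w stays in [0, 1], where V' is continuous.\<close>
  have "compact (V' ` {0..1})"
    by (intro compact_continuous_image continuous_on_subset[OF c]) auto
  then have "bounded (V' ` {0..1})" by (rule compact_imp_bounded)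
  then obtain K where "\<forall>y\<in>V' ` {0..1}. norm y \<le> K" by (auto simp: bounded_iff)
  then have K: "\<bar>V' x\<bar> \<le> K" if "x \<in> {0..1}" for x using that by simp
  have "deriv (Wf V) w \<le> K" if "1 \<le> w" for w
  proof -
    have "deriv (Wf V) w = - V' (1 / w) / w\<^sup>2" by (rule DERIV_imp_deriv[OF dW[OF that]])
    also have "\<dots> \<le> \<bar>V' (1 / w)\<bar> / w\<^sup>2" by (intro divide_right_mono) auto
    also have "\<dots> \<le> \<bar>V' (1 / w)\<bar>" using that by (simp add: divide_le_eq mult_le_cancel_left1)
    also have "\<dots> \<le> K" using that by (intro K) auto
    finally show ?thesis .
  qed
  then have bdd: "bdd_above (deriv (Wf V) ` {1..})" by (intro bdd_aboveI2) auto
  show "0 \<le> Wf V y - Wf V x"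
    using V_noninc xy by (auto simp: Wf_def frac_le)
  show "Wf V y - Wf V x \<le> (SUP w\<in>{1..}. deriv (Wf V) w) * (y - x)"
  proof (cases "x = y")
    case False
    then have "x < y" using xy by simp
    then obtain w where w: "x < w" "w < y" and eq: "Wf V y - Wf V x = (y - x) * (- V' (1 / w) / w\<^sup>2)"
      using MVT2[of x y "Wf V" "\<lambda>w. - V' (1 / w) / w\<^sup>2"] dW xy by auto
    have "1 \<le> w" using w xy by simp
    then have "- V' (1 / w) / w\<^sup>2 \<le> (SUP w\<in>{1..}. deriv (Wf V) w)"
      using cSUP_upper[OF _ bdd, of w] DERIV_imp_deriv[OF dW, of w] by simp
    then have "(y - x) * (- V' (1 / w) / w\<^sup>2) \<le> (y - x) * (SUP w\<in>{1..}. deriv (Wf V) w)"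
      using \<open>x < y\<close> by (intro mult_left_mono) auto
    then show ?thesis unfolding eq by (simp only: mult.commute)
  qed simp
qed

theorem theorem2p5:
  fixes Phi V y0 :: "real \<Rightarrow> real"
    and \<alpha> T M :: real
    and dt dz :: "nat \<Rightarrow> real"
  assumes Phi_nonneg: "\<forall>z\<ge>0. Phi z \<ge> 0"
    and Phi_noninc: "\<forall>x y. 0 \<le> x \<longrightarrow> x \<le> y \<longrightarrow> Phi y \<le> Phi x"
    and Phi_int: "set_integrable lborel {0..} Phi"
    and Phi_int1: "(LINT z:{0..}|lborel. Phi z) = 1"
    and Phi_moment: "set_integrable lborel {0..} (\<lambda>z. z * Phi z)"
    and V_C1: "\<exists>V'. continuous_on {0..} V' \<and>
                 (\<forall>x\<ge>0. (V has_real_derivative V' x) (at x within {0..}))"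
    and V_noninc: "\<forall>x y. 0 \<le> x \<longrightarrow> x \<le> y \<longrightarrow> V y \<le> V x"
    and alpha_pos: "\<alpha> > 0"
    and T_pos: "0 < T"
    and y0_meas: "y0 \<in> borel_measurable lborel"
    and y0_BV: "BV_real y0"
    and y0_ge1: "\<forall>z. y0 z \<ge> 1"
    and dt_pos: "\<forall>k. dt k > 0" and dz_pos: "\<forall>k. dz k > 0"
    and dt_lim: "dt \<longlonglongrightarrow> 0" and dz_lim: "dz \<longlonglongrightarrow> 0"
    and CFL: "\<forall>k. 0 \<le> (dt k / dz k) * (SUP w\<in>{1..}. deriv (Wf V) w)
                 \<and> (dt k / dz k) * (SUP w\<in>{1..}. deriv (Wf V) w) \<le> 1"
    and init_deriv: "\<forall>k z D. ((\<lambda>x. w_approx Phi \<alpha> V y0 (dz k) (dt k) x 0)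
                                has_real_derivative D) (at z) \<longrightarrow> \<bar>D\<bar> \<le> M"
  shows "(\<exists>w. lipschitz_strip T w
            \<and> (\<forall>K. compact K \<longrightarrow> (\<forall>\<epsilon>>0. eventually (\<lambda>k. \<forall>z\<in>K. \<forall>t\<in>{0..T}.
                  \<bar>w_approx Phi \<alpha> V y0 (dz k) (dt k) z t - w z t\<bar> < \<epsilon>) sequentially))
            \<and> weak_sol Phi \<alpha> V T w
            \<and> (\<forall>z. w z 0 = avg Phi \<alpha> y0 z))
         \<and> (\<forall>u1 u2. lipschitz_strip T u1 \<longrightarrow> lipschitz_strip T u2
              \<longrightarrow> (\<forall>z. \<forall>t\<in>{0..T}. u1 z t \<ge> 1 \<and> u2 z t \<ge> 1)
              \<longrightarrow> weak_sol Phi \<alpha> V T u1 \<longrightarrow> weak_sol Phi \<alpha> V T u2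
              \<longrightarrow> (\<forall>z. u1 z 0 = u2 z 0)
              \<longrightarrow> (\<forall>z. \<forall>t\<in>{0..T}. u1 z t = u2 z t))"
proof -
  define F where "F = kern Phi \<alpha>"
  define \<Lambda> where "\<Lambda> = (SUP w\<in>{1..}. deriv (Wf V) w)"
  \<comment> \<open>Truncation by \<open>max 1\<close> does not increase distances, so the Lipschitz
    constant \<Lambda> is kept, and all values lie between V 1 and V 0.\<close>
  define W where "W x = Wf V (max 1 x)" for x
  define Bw where "Bw = \<bar>V 0\<bar> + \<bar>V 1\<bar>"
  note Wf = Wf_increment[OF V_C1 V_noninc, folded \<Lambda>_def]
  have W_lip: "\<bar>W x - W y\<bar> \<le> \<Lambda> * \<bar>x - y\<bar>" for x y
  proof -
    have \<Lambda>: "0 \<le> \<Lambda>" using Wf[of 1 2] by simp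
    have *: "\<bar>W x - W y\<bar> \<le> \<Lambda> * (y - x)" if "x \<le> y" for x y
    proof -
      have "\<bar>W x - W y\<bar> \<le> \<Lambda> * (max 1 y - max 1 x)"
        using Wf[of "max 1 x" "max 1 y"] that by (simp add: W_def)
      also have "\<dots> \<le> \<Lambda> * (y - x)" using \<Lambda> that by (intro mult_left_mono) auto
      finally show ?thesis .
    qed
    show ?thesis using *[of x y] *[of y x] by (cases "x \<le> y") (auto simp: abs_minus_commute)
  qed
  have W_bound: "\<bar>W x\<bar> \<le> Bw" for x
  proof -
    have "V 1 \<le> W x" "W x \<le> V 0" using V_noninc by (auto simp: W_def Wf_def)
    then show ?thesis by (auto simp: Bw_def)
  qed
  have "kernel F" unfolding F_def by (rule kernel_kern[OF Phi_nonneg Phi_noninc Phi_int Phi_int1 alpha_pos])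
  then interpret nonlocal_flux F W Bw \<Lambda>
    by (intro nonlocal_flux.intro nonlocal_flux_axioms.intro W_lip W_bound)
  note avg = avg_eq_av[OF F_def] and Phi_ij = Phi_ij_eq_cellw[OF F_def]
  have W_eq: "W x = Wf V x" if "1 \<le> x" for x using that by (simp add: W_def max_absorb2)
  have weak_iff: "weak_sol Phi \<alpha> V T u \<longleftrightarrow> weak T u" if u: "\<And>z t. t \<in> {0..T} \<Longrightarrow> 1 \<le> u z t" for u
  proof -
    have "avg Phi \<alpha> (\<lambda>x. Wf V (u x t)) z = Aw u z t" if "t \<in> {0..T}" for z t
      using u[OF that] by (simp add: avg Aw_def W_eq)
    then have "(LINT t:{0..T}|lborel. LINT z|lborel. u z t * deriv (\<lambda>s. \<phi> (z, s)) t
         - avg Phi \<alpha> (\<lambda>x. Wf V (u x t)) z * deriv (\<lambda>s. \<phi> (s, t)) z)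
       = (LINT t:{0..T}|lborel. LINT z|lborel. u z t * deriv (\<lambda>s. \<phi> (z, s)) t
         - Aw u z t * deriv (\<lambda>s. \<phi> (s, t)) z)" for \<phi>
      by (intro set_lebesgue_integral_cong) simp_all
    then show ?thesis by (simp add: weak_sol_def weak_def)
  qed
  have [measurable]: "y0 \<in> borel_measurable borel" using y0_meas by simp
  obtain B where B: "\<And>x. \<bar>y0 x\<bar> \<le> B" using BV_real_bounded[OF y0_BV] by blast
  have B0: "0 \<le> B" using B[of 0] by linarith
  define L0 where "L0 = 2 * F 0 * B"
  have L0: "0 \<le> L0" using F_nonneg B0 by (simp add: L0_def)
  have a_lip: "\<bar>av y0 x - av y0 y\<bar> \<le> L0 * \<bar>x - y\<bar>" for x y
    unfolding L0_def by (rule av_lipschitz) (use B in auto)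
  obtain u where u_reg: "regular L0 u" and u0: "\<And>z. u z 0 = av y0 z"
    and u_eq: "\<And>z t. 0 \<le> t \<Longrightarrow> u z t = av y0 z + integral {0..t} (\<lambda>s. N u s z)"
    using mild_solution_exists[OF a_lip] by blast
  have u_mild: "mild T' u" for T'
    unfolding mild_def u0 by (intro allI ballI u_eq) simp
  \<comment> \<open>Interpolation at times up to T reads nodes up to T + dt, which is covered once
    dt <= 1.\<close>
  define T' where "T' = T + 1"
  define L where "L = L0 * exp (C * T') + 2 * F 0 * Bw"
  have T': "0 \<le> T'" "T \<le> T'" using T_pos by (auto simp: T'_def)
  have u_lip: "lip_on L T' u" unfolding L_def by (rule regular_lip_on[OF u_reg L0 T'(1)])
  then have u_lip_T: "lip_on L T u" using T' unfolding lip_on_def by auto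
  have L: "0 \<le> L" by (rule lip_on_nonneg[OF u_lip T'(1)])

  have cell: "cell_avg y0 h (i + int m)
      = (1 / h) * (LINT x:{real m * h..real (Suc m) * h}|lborel. y0 (real_of_int (i - 1) * h + x))" for h i m
    unfolding cell_avg_def add.commute[of "real_of_int (i - 1) * h"] set_integral_shift[symmetric]
    by (simp add: algebra_simps)
  define s where "s k = scheme Phi \<alpha> V y0 (dz k) (dt k)" for k
  have s0: "s k 0 i = (\<Sum>m. cellw (dz k) m * cell_avg y0 (dz k) (i + int m))" for k i
    using dz_pos by (simp add: s_def Phi_ij)
  note cell_err = av_cell_average_error[OF dz_pos[rule_format] \<open>y0 \<in> borel_measurable borel\<close> B cell]
  \<comment> \<open>The extended and the original flux are known to agree only from 1 upwards, so
    this form of the scheme becomes available level by level along the induction for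
    \<open>s_ge\<close>.\<close>
  have Wbar: "Wbar_if Phi \<alpha> V (dz k) (s k n) i
      = av (stepf (dz k) (\<lambda>j. W (s k n j))) (real_of_int (i - 1) * dz k)"
    if "\<And>j. 1 \<le> s k n j" for k n i
    using sums_unique[OF cellw_step_sums[where v="\<lambda>j. W (s k n j)", OF dz_pos[rule_format] W_bound, of k i]] dz_pos that
    by (simp add: Wbar_if_def Phi_ij W_eq)
  have s_ge: "1 \<le> s k n i" for k n i
  proof (induction n arbitrary: i)
    case 0
    have "1 \<le> cell_avg y0 (dz k) (i + int m)" for m
    proof -
      let ?a = "real m * dz k" and ?b = "real (Suc m) * dz k"
      have "1 \<le> (1 / (?b - ?a)) * (LINT x:{?a..?b}|lborel. y0 (real_of_int (i - 1) * dz k + x))"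
        by (rule interval_mean_ge[where K=B]) (use B y0_ge1 dz_pos in auto)
      moreover have "?b - ?a = dz k" by (simp add: algebra_simps)
      ultimately show ?thesis unfolding cell by simp
    qed
    then have "cellw (dz k) m \<le> cellw (dz k) m * cell_avg y0 (dz k) (i + int m)" for m
      using mult_left_mono[OF _ cellw_nonneg, of 1 _ "dz k" m] by simp
    then have "(\<Sum>m. cellw (dz k) m) \<le> (\<Sum>m. cellw (dz k) m * cell_avg y0 (dz k) (i + int m))"
      using cellw_sums[OF dz_pos[rule_format, of k]] cell_err(1) by (intro suminf_le) (auto simp: sums_iff)
    then show ?case using cellw_sums[OF dz_pos[rule_format, of k]] by (simp add: s0 sums_iff)
  next
    case (Suc n)
    let ?lam = "dt k / dz k"
    let ?S = "stepf (dz k) (\<lambda>j. W (s k n j))"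
    let ?D = "av ?S (real_of_int i * dz k) - av ?S (real_of_int (i - 1) * dz k)"
    have step: "s k (Suc n) i = s k n i + ?lam * ?D"
      using Wbar[of k n, OF Suc] by (simp add: s_def)
    have x: "1 \<le> s k n i" by (rule Suc)
    have lam: "0 \<le> ?lam" "?lam * \<Lambda> \<le> 1"
      using dt_pos dz_pos CFL by (auto simp: \<Lambda>_def less_imp_le)
    have mono: "W 1 \<le> W (s k n j)" for j
      using Wf(1)[of 1 "s k n j"] Suc[of j] by (simp add: W_eq)
    \<comment> \<open>At worst the flux difference removes W(s) - W 1 <= \<Lambda> (s - 1), where s
      is the old value. Multiplied by dt / dz this is at most s - 1 by the CFL condition, so the new
      value stays at least 1.\<close>
    have "- (W (s k n i) - W 1) \<le> ?D"
      by (rule av_step_difference_ge[OF dz_pos[rule_format] W_bound mono])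
    moreover have "W (s k n i) - W 1 \<le> \<Lambda> * (s k n i - 1)"
      using Wf(2)[of 1 "s k n i"] x by (simp add: W_eq)
    ultimately have "- (\<Lambda> * (s k n i - 1)) \<le> ?D" by linarith
    then have "?lam * - (\<Lambda> * (s k n i - 1)) \<le> ?lam * ?D" by (rule mult_left_mono[OF _ lam(1)])
    moreover have "?lam * \<Lambda> * (s k n i - 1) \<le> 1 * (s k n i - 1)"
      using x lam by (intro mult_right_mono) auto
    ultimately show ?case unfolding step by (simp add: mult.assoc)
  qed
  have s_Suc: "s k (Suc n) i = s k n i + (dt k / dz k) *
      (av (stepf (dz k) (\<lambda>j. W (s k n j))) (real_of_int i * dz k)
       - av (stepf (dz k) (\<lambda>j. W (s k n j))) (real_of_int (i - 1) * dz k))" for k n i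
    using Wbar[of k n, OF s_ge] by (simp add: s_def)
  \<comment> \<open>Two sources: cell averages in place of y0, and the half-cell offset between the
    interface at which the sum is based and the node z_i.\<close>
  define E where "E k = (2 * B * F 0 + L0) * dz k" for k
  have s0_err: "\<bar>s k 0 i - u ((real_of_int i - 1/2) * dz k) 0\<bar> \<le> E k" for k i
  proof -
    have "\<bar>s k 0 i - av y0 (real_of_int (i - 1) * dz k)\<bar> \<le> 2 * B * F 0 * dz k"
      unfolding s0 by (rule cell_err(2))
    moreover have "\<bar>av y0 (real_of_int (i - 1) * dz k) - av y0 ((real_of_int i - 1/2) * dz k)\<bar> \<le> L0 * dz k"
    proof (rule order_trans[OF a_lip])
      have "\<bar>real_of_int (i - 1) * dz k - (real_of_int i - 1/2) * dz k\<bar> \<le> dz k"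
        using dz_pos[rule_format, of k] by (simp add: algebra_simps)
      then show "L0 * \<bar>real_of_int (i - 1) * dz k - (real_of_int i - 1/2) * dz k\<bar> \<le> L0 * dz k"
        by (rule mult_left_mono[OF _ L0])
    qed
    ultimately show ?thesis unfolding u0 E_def by (simp only: distrib_right)
  qed
  define err where "err k = exp (C * T') * (E k + L * (2 * dz k + dt k)) + L * (dz k + dt k)" for k
  have approx: "\<bar>w_approx Phi \<alpha> V y0 (dz k) (dt k) z t - u z t\<bar> \<le> err k"
    if "dt k \<le> 1" "t \<in> {0..T}" for k z t
    unfolding w_approx_def err_def s_def[symmetric]
  proof (rule bilin_error[OF dz_pos[rule_format] dt_pos[rule_format] u_lip])
    show "\<bar>s k n i - u ((real_of_int i - 1/2) * dz k) (real n * dt k)\<bar>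
        \<le> exp (C * T') * (E k + L * (2 * dz k + dt k))" if "real n * dt k \<le> T'" for n i
      by (rule scheme_error[where w="s k", OF u_lip u_mild dz_pos[rule_format] dt_pos[rule_format]
            T'(1) s0_err s_Suc that])
  qed (use that in \<open>auto simp: T'_def\<close>)
  have "err \<longlonglongrightarrow> exp (C * T') * ((2 * B * F 0 + L0) * 0 + L * (2 * 0 + 0)) + L * (0 + 0)"
    unfolding err_def E_def by (intro tendsto_intros dt_lim dz_lim)
  then have err: "err \<longlonglongrightarrow> 0" by simp
  have dt1: "\<forall>\<^sub>F k in sequentially. dt k \<le> 1"
    using order_tendstoD(2)[OF dt_lim, of 1] by (auto elim: eventually_mono)
  have conv: "\<forall>\<^sub>F k in sequentially. \<forall>z\<in>K. \<forall>t\<in>{0..T}.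
      \<bar>w_approx Phi \<alpha> V y0 (dz k) (dt k) z t - u z t\<bar> < \<epsilon>" if "0 < \<epsilon>" for K \<epsilon>
    using dt1 order_tendstoD(2)[OF err that]
    by eventually_elim (blast intro: le_less_trans[OF approx])
  \<comment> \<open>With this bound, passed on from the interpolants, u solves the equation with the
    original flux.\<close>
  have u_ge: "1 \<le> u z t" if t: "t \<in> {0..T}" for z t
  proof (rule field_le_epsilon)
    fix \<epsilon> :: real assume "0 < \<epsilon>"
    from eventually_happens[OF conv[OF this, of UNIV]] obtain k
      where "\<bar>w_approx Phi \<alpha> V y0 (dz k) (dt k) z t - u z t\<bar> < \<epsilon>" using t by fastforce
    moreover have "1 \<le> w_approx Phi \<alpha> V y0 (dz k) (dt k) z t"
      unfolding w_approx_def s_def[symmetric] using t dz_pos dt_pos s_ge by (intro bilin_ge) auto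
    ultimately show "1 \<le> u z t + \<epsilon>" by linarith
  qed
  have "weak_sol Phi \<alpha> V T u"
    using mild_imp_weak[OF u_lip_T T_pos u_mild] weak_iff[OF u_ge] by simp
  then have ex: "\<exists>w. lipschitz_strip T w
            \<and> (\<forall>K. compact K \<longrightarrow> (\<forall>\<epsilon>>0. eventually (\<lambda>k. \<forall>z\<in>K. \<forall>t\<in>{0..T}.
                  \<bar>w_approx Phi \<alpha> V y0 (dz k) (dt k) z t - w z t\<bar> < \<epsilon>) sequentially))
            \<and> weak_sol Phi \<alpha> V T w
            \<and> (\<forall>z. w z 0 = avg Phi \<alpha> y0 z)"
    using u_lip_T conv u0 by (intro exI[of _ u]) (auto simp: lipschitz_strip_iff avg)
  have uniq: "u1 z t = u2 z t"
    if "lipschitz_strip T u1" "lipschitz_strip T u2" "\<forall>z. \<forall>t\<in>{0..T}. u1 z t \<ge> 1 \<and> u2 z t \<ge> 1"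
      "weak_sol Phi \<alpha> V T u1" "weak_sol Phi \<alpha> V T u2" "\<forall>z. u1 z 0 = u2 z 0" "t \<in> {0..T}" for u1 u2 z t
  proof -
    note sol = that
    from sol(1) obtain L1 where l1: "lip_on L1 T u1" unfolding lipschitz_strip_iff ..
    from sol(2) obtain L2 where l2: "lip_on L2 T u2" unfolding lipschitz_strip_iff ..
    have ge: "1 \<le> u1 z t" "1 \<le> u2 z t" if "t \<in> {0..T}" for z t using sol(3) that by blast+
    have "mild T u1" by (rule weak_imp_mild[OF l1 T_pos iffD1[OF weak_iff[OF ge(1)] sol(4)]])
    moreover have "mild T u2" by (rule weak_imp_mild[OF l2 T_pos iffD1[OF weak_iff[OF ge(2)] sol(5)]])
    ultimately show ?thesis by (rule mild_unique[OF l1 l2 _ _ sol(6)[rule_format] sol(7)])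
  qed
  show ?thesis by (intro conjI ex allI impI ballI) (rule uniq)
qed

end
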